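(* Any (possibly randomized) $\alpha$-approximation CONGEST algorithm for the minimum cost $k$-edge-connected spanning subgraph ($k$-ECSS) problem in simple graphs requires $\Omega(D+\sqrt{n/k}/\log n)$ rounds, for any polynomial $\alpha\ge 1$. The lower bound holds even in graphs with diameter $D=O(\log n)$.
   Context: CONGEST model: the communication network is the input graph $G$ (simple, i.e. without parallel edges) with $n$ vertices and diameter $D$. Vertices have unique $O(\log n)$-bit identifiers and communicate in synchronous rounds; in each round each vertex may send an $O(\log n)$-bit message over each incident edge. Initially a vertex knows only its incident edges and their weights (non-negative integers polynomial in $n$). At the end each vertex must know which of its incident edges belong to the output subgraph. A graph is $k$-edge-connected if it remains connected after the removal of any $k-1$ edges. In the minimum cost $k$-ECSS problem the goal is to find a minimum cost $k$-edge-connected spanning subgraph of a given weighted $k$-edge-connected graph $G$ (cost = sum of edge weights). An $\alpha$-approximation algorithm outputs (with high probability, i.e. at least $1-1/n^{c}$ for a constant $c\geq 1$, if randomized) a $k$-edge-connected spanning subgraph of cost at most $\alpha$ times the optimum; $\alpha=\alpha(n)$ is bounded by a polynomial in $n$. The lower bound is on the worst-case number of rounds over inputs. *)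

theory Defs
  imports "HOL-Probability.Probability" "HOL-Computational_Algebra.Polynomial"
begin

section \<open>Simple graphs\<close>

text \<open>An undirected simple graph is a finite vertex set together with a set of two-element
  vertex sets. A vertex \<^emph>\<open>is\<close> its unique identifier.\<close>

definition simple_graph :: "'v set \<Rightarrow> 'v set set \<Rightarrow> bool" where
  "simple_graph V E \<longleftrightarrow> finite V \<and> E \<subseteq> {e. e \<subseteq> V \<and> card e = 2}"

definition adj :: "'v set set \<Rightarrow> 'v \<Rightarrow> 'v \<Rightarrow> bool" where
  "adj E u v \<longleftrightarrow> {u, v} \<in> E"

definition connected_graph :: "'v set \<Rightarrow> 'v set set \<Rightarrow> bool" where
  "connected_graph V E \<longleftrightarrow> (\<forall>u\<in>V. \<forall>v\<in>V. (adj E)\<^sup>*\<^sup>* u v)"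

definition k_edge_connected :: "nat \<Rightarrow> 'v set \<Rightarrow> 'v set set \<Rightarrow> bool" where
  "k_edge_connected k V E \<longleftrightarrow> (\<forall>F\<subseteq>E. finite F \<and> card F < k \<longrightarrow> connected_graph V (E - F))"

definition hop_dist :: "'v set set \<Rightarrow> 'v \<Rightarrow> 'v \<Rightarrow> nat" where
  "hop_dist E u v = (LEAST d. (adj E ^^ d) u v)"

definition diam :: "'v set \<Rightarrow> 'v set set \<Rightarrow> nat" where
  "diam V E = Max {hop_dist E u v | u v. u \<in> V \<and> v \<in> V}"

section \<open>The minimum cost k-ECSS problem\<close>

record network =
  verts :: "nat set"
  edges :: "nat set set"
  weight :: "nat set \<Rightarrow> nat"

abbreviation hop_diameter :: "network \<Rightarrow> nat" where
  "hop_diameter G \<equiv> diam (verts G) (edges G)"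

text \<open>Identifiers of \<open>O(log n)\<close> bits and weights polynomial in \<open>n\<close>: identifiers are smaller
  than \<open>n ^ i\<close> and weights are at most \<open>n ^ w\<close>, for constants \<open>i\<close> and \<open>w\<close>.\<close>

definition kecss_input :: "nat \<Rightarrow> nat \<Rightarrow> nat \<Rightarrow> nat \<Rightarrow> network \<Rightarrow> bool" where
  "kecss_input i w k n G \<longleftrightarrow>
     simple_graph (verts G) (edges G) \<and> card (verts G) = n \<and>
     verts G \<subseteq> {..<n ^ i} \<and> (\<forall>e\<in>edges G. weight G e \<le> n ^ w) \<and>
     k_edge_connected k (verts G) (edges G)"

definition is_kecss :: "nat \<Rightarrow> network \<Rightarrow> nat set set \<Rightarrow> bool" where
  "is_kecss k G H \<longleftrightarrow> H \<subseteq> edges G \<and> k_edge_connected k (verts G) H"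

definition cost :: "network \<Rightarrow> nat set set \<Rightarrow> nat" where
  "cost G H = (\<Sum>e\<in>H. weight G e)"

definition opt_cost :: "nat \<Rightarrow> network \<Rightarrow> nat" where
  "opt_cost k G = Min {cost G H | H. is_kecss k G H}"

definition approx_kecss :: "nat \<Rightarrow> real \<Rightarrow> network \<Rightarrow> nat set set \<Rightarrow> bool" where
  "approx_kecss k a G H \<longleftrightarrow> is_kecss k G H \<and> real (cost G H) \<le> a * real (opt_cost k G)"

section \<open>Randomized CONGEST algorithms\<close>

text \<open>Local computation is unbounded. States are natural numbers: what a vertex can have
  learned after finitely many rounds ranges over a countable set, so any algorithm can be encoded
  this way; a state type parameter would instead let the constants of a lower bound depend on
  that type.\<close>

type_synonym state = nat
type_synonym message = "bool list"

text \<open>\<open>init v inc\<close> is the (random) initial state of vertex \<open>v\<close>, where \<open>inc u\<close> is the weight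
  of the edge \<open>{v, u}\<close>, or \<open>None\<close> if there is no such edge. \<open>send s u\<close> is the message a vertex
  in state \<open>s\<close> sends to its neighbour \<open>u\<close>, and \<open>step s m\<close> is its next (random) state when
  \<open>m u\<close> is the message received from \<open>u\<close>. \<open>result s = Some S\<close> means that the vertex has
  terminated and selects exactly its incident edges leading to \<open>S\<close>.\<close>

record algorithm =
  init :: "nat \<Rightarrow> (nat \<Rightarrow> nat option) \<Rightarrow> state pmf"
  send :: "state \<Rightarrow> nat \<Rightarrow> message"
  step :: "state \<Rightarrow> (nat \<Rightarrow> message) \<Rightarrow> state pmf"
  result :: "state \<Rightarrow> nat set option"

definition incident :: "network \<Rightarrow> nat \<Rightarrow> nat \<Rightarrow> nat option" where
  "incident G v u = (if {v, u} \<in> edges G then Some (weight G {v, u}) else None)"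

definition inbox :: "algorithm \<Rightarrow> network \<Rightarrow> (nat \<Rightarrow> state) \<Rightarrow> nat \<Rightarrow> nat \<Rightarrow> message" where
  "inbox A G cfg v u = (if {v, u} \<in> edges G then send A (cfg u) v else [])"

text \<open>The distribution of the global configuration after \<open>t\<close> synchronous rounds. The vertices
  use private, independent randomness; \<open>0\<close> is the dummy value outside the vertex set.\<close>

primrec run :: "algorithm \<Rightarrow> network \<Rightarrow> nat \<Rightarrow> (nat \<Rightarrow> state) pmf" where
  "run A G 0 = Pi_pmf (verts G) 0 (\<lambda>v. init A v (incident G v))"
| "run A G (Suc t) =
     bind_pmf (run A G t) (\<lambda>cfg. Pi_pmf (verts G) 0 (\<lambda>v. step A (cfg v) (inbox A G cfg v)))"

definition irrevocable :: "algorithm \<Rightarrow> bool" where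
  "irrevocable A \<longleftrightarrow>
     (\<forall>s S m. result A s = Some S \<longrightarrow> (\<forall>s'\<in>set_pmf (step A s m). result A s' = Some S))"

text \<open>Every message ever sent has at most \<open>b log n\<close> bits.\<close>

definition respects_bandwidth :: "nat \<Rightarrow> algorithm \<Rightarrow> network \<Rightarrow> bool" where
  "respects_bandwidth b A G \<longleftrightarrow>
     (\<forall>t. \<forall>cfg\<in>set_pmf (run A G t). \<forall>v u. {v, u} \<in> edges G \<longrightarrow>
        real (length (send A (cfg v) u)) \<le> real b * log 2 (real (card (verts G))))"

text \<open>All vertices have terminated, and their local outputs agree with a single edge set that is
  an \<open>\<alpha>(n)\<close>-approximate solution.\<close>

definition solved :: "nat \<Rightarrow> (nat \<Rightarrow> real) \<Rightarrow> algorithm \<Rightarrow> network \<Rightarrow> (nat \<Rightarrow> state) \<Rightarrow> bool" where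
  "solved k \<alpha> A G cfg \<longleftrightarrow>
     (\<exists>H. approx_kecss k (\<alpha> (card (verts G))) G H \<and>
          (\<forall>v\<in>verts G. result A (cfg v) = Some {u. {v, u} \<in> H}))"

definition solved_whp_by ::
  "real \<Rightarrow> nat \<Rightarrow> (nat \<Rightarrow> real) \<Rightarrow> algorithm \<Rightarrow> network \<Rightarrow> nat \<Rightarrow> bool" where
  "solved_whp_by \<gamma> k \<alpha> A G t \<longleftrightarrow>
     measure_pmf.prob (run A G t) {cfg. solved k \<alpha> A G cfg}
       \<ge> 1 - 1 / real (card (verts G)) powr \<gamma>"

definition approx_algorithm ::
  "nat \<Rightarrow> nat \<Rightarrow> nat \<Rightarrow> real \<Rightarrow> nat \<Rightarrow> (nat \<Rightarrow> real) \<Rightarrow> algorithm \<Rightarrow> bool" where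
  "approx_algorithm b i w \<gamma> k \<alpha> A \<longleftrightarrow>
     irrevocable A \<and>
     (\<forall>n\<ge>1. \<forall>G. kecss_input i w k n G \<longrightarrow>
        respects_bandwidth b A G \<and> (\<exists>t. solved_whp_by \<gamma> k \<alpha> A G t))"

text \<open>The number of rounds after which, with high probability, all vertices have terminated with
  a correct output. If \<open>A\<close> is correct with high probability and always terminates within \<open>T\<close>
  rounds on \<open>G\<close>, then this number is at most \<open>T\<close>, so lower bounds on it are lower bounds on the
  worst-case number of rounds.\<close>

definition rounds :: "real \<Rightarrow> nat \<Rightarrow> (nat \<Rightarrow> real) \<Rightarrow> algorithm \<Rightarrow> network \<Rightarrow> nat" where
  "rounds \<gamma> k \<alpha> A G = (LEAST t. solved_whp_by \<gamma> k \<alpha> A G t)"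

definition polynomially_bounded :: "(nat \<Rightarrow> real) \<Rightarrow> bool" where
  "polynomially_bounded \<alpha> \<longleftrightarrow> (\<exists>p :: real poly. \<forall>n. \<alpha> n \<le> poly p (real n))"

text \<open>The lower bound \<open>D + sqrt (n / k) / log n\<close>, up to the constant factor.\<close>

definition lower_bound :: "nat \<Rightarrow> nat \<Rightarrow> nat \<Rightarrow> real" where
  "lower_bound k n D = real D + sqrt (real n / real k) / log 2 (real n)"

end

theory Submission
  imports Defs
begin

text \<open>All weights are 0 or 1, so an approximation algorithm, whatever its ratio, has to decide whether
  the edges of weight 0 form a \<open>k\<close>-edge-connected spanning subgraph. In the networks used here this holds
  iff the inner product of two bit vectors \<open>x\<close> and \<open>y\<close> is odd, where \<open>x\<close> only affects weights at the left
  end of a bundle of long parallel paths and \<open>y\<close> only those at the right end. Every vertex of the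
  bundle is blown up to a clique of at least \<open>k + 2\<close> vertices. An additional path of single vertices
  carries shortcuts of length \<open>2 ^ e\<close>, which make the diameter logarithmic, although
  any cut between two columns is crossed by only logarithmically many of them.

  If the number \<open>T\<close> of rounds is less than half the length of the paths, then the two ends
  interact only through the messages on these few shortcuts. After the randomness has been fixed,
  the inputs with equal messages form combinatorial rectangles, and by Lindsey's lemma too few
  rectangles cannot approximate the inner product. For the bound \<open>\<Omega>(D)\<close>, no
  shortcuts and a constant number of bits suffice.\<close>

section \<open>Discrepancy of the inner product function\<close>

text \<open>The shape of the bound is a vertex budget. In \<open>T\<close> rounds the shortcuts
  carry about \<open>T * log n\<close> messages of \<open>O(log n)\<close> bits, so \<open>m\<close>
  must be of order \<open>T * (log n)^2\<close>; the bundle then has about \<open>T * m * k\<close>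
  vertices, and equating this with \<open>n\<close> gives \<open>T\<close> of order
  \<open>sqrt (n / k) / log n\<close>.

  Two demands conflict. Surviving \<open>k - 1\<close> deletions calls for fat fibres, but a
  shortcut between two fat fibres would become about \<open>k^2\<close> edges, each with its own
  messages. So shortcuts join single vertices, and these get their robustness from edges into a fat
  fibre of the same column. Connectivity is therefore always argued along steps with at least one
  fat end.

  Fixing the randomness leaves an algorithm that is right on most input pairs only, under the
  uniform distribution. Disjointness would be useless there, as two random sets almost always
  intersect, whereas the inner product stays hard on average. It also suits a connectivity problem:
  parity decides whether two strands, closed up after several swaps, form one component.\<close>

abbreviation ip_sign :: "nat set \<Rightarrow> nat set \<Rightarrow> real" where
  "ip_sign x y \<equiv> (- 1) ^ card (x \<inter> y)"

text \<open>Toggling a fixed element of \<open>d\<close> is an involution of \<open>Pow U\<close>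
  that flips every sign.\<close>

lemma sum_ip_sign_Pow:
  assumes "finite U" "d \<subseteq> U" "d \<noteq> {}"
  shows "(\<Sum>x\<in>Pow U. ip_sign x d) = 0"
proof -
  obtain a where a: "a \<in> d" using assms(3) by blast
  have fd: "finite d" using assms finite_subset by blast
  define f where "f x = (if a \<in> x then x - {a} else insert a x)" for x
  have flip: "ip_sign (f x) d = - ip_sign x d" for x
  proof (cases "a \<in> x")
    case True
    then have "x \<inter> d = insert a (f x \<inter> d)" "a \<notin> f x \<inter> d" using a by (auto simp: f_def)
    then have "card (x \<inter> d) = Suc (card (f x \<inter> d))" using fd by simp
    then show ?thesis by simp
  next
    case False
    then have "f x \<inter> d = insert a (x \<inter> d)" "a \<notin> x \<inter> d" using a by (auto simp: f_def)
    then have "card (f x \<inter> d) = Suc (card (x \<inter> d))" using fd by simp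
    then show ?thesis by simp
  qed
  have ff: "f (f x) = x" for x by (auto simp: f_def)
  have fU: "f x \<in> Pow U" if "x \<in> Pow U" for x using that a assms(2) by (auto simp: f_def)
  have "(\<Sum>x\<in>Pow U. ip_sign x d) = (\<Sum>x\<in>Pow U. ip_sign (f x) d)"
    by (rule sum.reindex_bij_witness[of _ f f]) (simp_all only: ff fU)
  also have "\<dots> = - (\<Sum>x\<in>Pow U. ip_sign x d)" by (simp only: flip sum_negf)
  finally show ?thesis by simp
qed

text \<open>An element common to \<open>y\<close> and \<open>y'\<close> contributes twice and drops
  out of the sign.\<close>

lemma ip_sign_mult:
  assumes "finite x"
  shows "ip_sign x y * ip_sign x y' = ip_sign x ((y - y') \<union> (y' - y))"
proof -
  have 1: "card (x \<inter> y) = card (x \<inter> (y - y')) + card (x \<inter> y \<inter> y')"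
    using assms by (subst card_Un_disjoint[symmetric]) (auto intro!: arg_cong[where f = card])
  have 2: "card (x \<inter> y') = card (x \<inter> (y' - y)) + card (x \<inter> y \<inter> y')"
    using assms by (subst card_Un_disjoint[symmetric]) (auto intro!: arg_cong[where f = card])
  have 3: "card (x \<inter> ((y - y') \<union> (y' - y))) = card (x \<inter> (y - y')) + card (x \<inter> (y' - y))"
    using assms by (subst card_Un_disjoint[symmetric]) (auto intro!: arg_cong[where f = card])
  show ?thesis unfolding 1 2 3 by (simp add: power_add mult_ac power_mult_distrib[symmetric])
qed

text \<open>Cauchy-Schwarz over the rows, then orthogonality of the columns: with
  \<open>N = 2 ^ card U\<close> the squared sum is at most \<open>N ^ 3\<close>.\<close>

lemma lindsey:
  assumes U: "finite U" and A: "A \<subseteq> Pow U" and B: "B \<subseteq> Pow U"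
  shows "\<bar>\<Sum>x\<in>A. \<Sum>y\<in>B. ip_sign x y\<bar> \<le> sqrt (2 ^ (3 * card U))"
proof -
  have fA: "finite A" and fB: "finite B" using assms by (auto intro: finite_subset)
  define N where "N = (2::real) ^ card U"
  have "card X \<le> 2 ^ card U" if "X \<subseteq> Pow U" for X
    using card_mono[OF _ that] U by (simp add: card_Pow)
  then have card_le: "real (card X) \<le> N" if "X \<subseteq> Pow U" for X
    unfolding N_def using that by (metis of_nat_le_iff of_nat_numeral of_nat_power)
  note cA = card_le[OF A] and cB = card_le[OF B]
  have pair: "(\<Sum>x\<in>Pow U. ip_sign x y * ip_sign x y') = (if y = y' then N else 0)"
    if "y \<in> B" "y' \<in> B" for y y'
  proof -
    have "(\<Sum>x\<in>Pow U. ip_sign x y * ip_sign x y') = (\<Sum>x\<in>Pow U. ip_sign x ((y - y') \<union> (y' - y)))"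
      using U by (intro sum.cong ip_sign_mult) (auto intro: finite_subset)
    also have "\<dots> = (if y = y' then N else 0)"
    proof (cases "y = y'")
      case True
      then show ?thesis using U by (simp add: N_def card_Pow)
    next
      case False
      then have "(y - y') \<union> (y' - y) \<noteq> {}" by blast
      moreover have "(y - y') \<union> (y' - y) \<subseteq> U" using that B by blast
      ultimately show ?thesis using sum_ip_sign_Pow[OF U] False by auto
    qed
    finally show ?thesis .
  qed
  have "(\<Sum>x\<in>A. \<Sum>y\<in>B. ip_sign x y)\<^sup>2 \<le> (\<Sum>x\<in>A. (\<Sum>y\<in>B. ip_sign x y)\<^sup>2) * card A"
    by (rule sum_squared_le_sum_of_squares)
  \<comment> \<open>The row sums are squared by now, so the rows may be extended to all of
    \<open>Pow U\<close>, where \<open>pair\<close> applies.\<close>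
  also have "\<dots> \<le> (\<Sum>x\<in>Pow U. (\<Sum>y\<in>B. ip_sign x y)\<^sup>2) * N"
    using U A cA by (intro mult_mono sum_mono2 sum_nonneg) auto
  also have "(\<Sum>x\<in>Pow U. (\<Sum>y\<in>B. ip_sign x y)\<^sup>2)
      = (\<Sum>x\<in>Pow U. \<Sum>y\<in>B. \<Sum>y'\<in>B. ip_sign x y * ip_sign x y')"
    by (simp add: power2_eq_square sum_product)
  also have "\<dots> = (\<Sum>y\<in>B. \<Sum>y'\<in>B. \<Sum>x\<in>Pow U. ip_sign x y * ip_sign x y')"
    by (subst sum.swap, rule sum.cong[OF refl], rule sum.swap)
  also have "\<dots> = (\<Sum>y\<in>B. \<Sum>y'\<in>B. if y = y' then N else 0)"
    by (intro sum.cong refl pair)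
  also have "\<dots> = card B * N" using fB by (simp add: sum.delta)
  also have "card B * N * N \<le> N * N * N"
    using cB by (intro mult_right_mono) (auto simp: N_def)
  also have "\<dots> = 2 ^ (3 * card U)"
    by (simp add: N_def power_mult numeral_3_eq_3 power_add[symmetric] mult.commute)
  finally show ?thesis by (metis real_sqrt_abs real_sqrt_le_mono)
qed

text \<open>Closure under mixing is demanded of accepting inputs only: acceptance will be a
  conjunction over both ends, while rejection is not rectangular. Each class of \<tau> thus
  contributes one rectangle, and the rejected inputs enter through the sum over the whole
  square.\<close>

lemma rectangles_compute_inner_product:
  fixes m :: nat and \<tau> :: "nat set \<times> nat set \<Rightarrow> 'c" and acc :: "nat set \<times> nat set \<Rightarrow> bool"
  defines "I \<equiv> Pow {..<m} \<times> Pow {..<m}"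
  assumes rect: "\<And>x y x' y'. (x, y) \<in> I \<Longrightarrow> (x', y') \<in> I \<Longrightarrow> \<tau> (x, y) = \<tau> (x', y') \<Longrightarrow>
      acc (x, y) \<Longrightarrow> acc (x', y') \<Longrightarrow> \<tau> (x, y') = \<tau> (x, y) \<and> acc (x, y')"
    and card_\<tau>: "real (card (\<tau> ` I)) \<le> 2 ^ X"
    and correct: "7 / 8 * 4 ^ m \<le> real (card {\<iota> \<in> I. acc \<iota> \<longleftrightarrow> odd (card (fst \<iota> \<inter> snd \<iota>))})"
  shows "m \<le> 2 * X + 4"
proof -
  define f where "f \<iota> = ip_sign (fst \<iota>) (snd \<iota>)" for \<iota> :: "nat set \<times> nat set"
  define M where "M = sqrt (2 ^ (3 * m))"
  have fI: "finite I" by (simp add: I_def)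
  have cI: "card I = 4 ^ m"
    by (simp add: I_def card_cartesian_product card_Pow flip: power_mult_distrib)
  have box: "\<bar>sum f (P \<times> Q)\<bar> \<le> M" if "P \<subseteq> Pow {..<m}" "Q \<subseteq> Pow {..<m}" for P Q
  proof -
    have "sum f (P \<times> Q) = (\<Sum>x\<in>P. \<Sum>y\<in>Q. ip_sign x y)"
      by (simp add: sum.cartesian_product f_def case_prod_unfold)
    then show ?thesis using lindsey[OF finite_lessThan that] by (simp add: M_def)
  qed
  have per_class: "\<bar>sum f {\<iota> \<in> {\<iota> \<in> I. acc \<iota>}. \<tau> \<iota> = \<sigma>}\<bar> \<le> M" for \<sigma>
  proof -
    let ?R = "{\<iota> \<in> {\<iota> \<in> I. acc \<iota>}. \<tau> \<iota> = \<sigma>}"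
    have eq: "?R = fst ` ?R \<times> snd ` ?R"
    proof (intro equalityI subsetI)
      fix \<iota> assume "\<iota> \<in> fst ` ?R \<times> snd ` ?R"
      then obtain x y x' y' where "\<iota> = (x, y')" "(x, y) \<in> ?R" "(x', y') \<in> ?R"
        by (cases \<iota>) force
      then show "\<iota> \<in> ?R" using rect[of x y x' y'] by (auto simp: I_def)
    next
      fix \<iota> assume "\<iota> \<in> ?R"
      then show "\<iota> \<in> fst ` ?R \<times> snd ` ?R" by (simp only: mem_Times_iff imageI)
    qed
    have "fst ` ?R \<subseteq> Pow {..<m}" "snd ` ?R \<subseteq> Pow {..<m}" by (auto simp: I_def)
    then show ?thesis by (subst eq) (rule box)
  qed
  have "sum f {\<iota> \<in> I. acc \<iota>} = (\<Sum>\<sigma>\<in>\<tau> ` I. sum f {\<iota> \<in> {\<iota> \<in> I. acc \<iota>}. \<tau> \<iota> = \<sigma>})"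
    using fI by (intro sum.group[symmetric]) auto
  then have "\<bar>sum f {\<iota> \<in> I. acc \<iota>}\<bar> \<le> (\<Sum>\<sigma>\<in>\<tau> ` I. M)"
    by (metis (no_types, lifting) per_class order_trans sum_abs sum_mono)
  also have "\<dots> \<le> 2 ^ X * M" using card_\<tau> by (simp add: M_def mult_right_mono)
  finally have acc_le: "\<bar>sum f {\<iota> \<in> I. acc \<iota>}\<bar> \<le> 2 ^ X * M" .
  have all_le: "\<bar>sum f I\<bar> \<le> M" unfolding I_def by (rule box) auto
  define C where "C = {\<iota> \<in> I. acc \<iota> \<longleftrightarrow> odd (card (fst \<iota> \<inter> snd \<iota>))}"
  have CI: "C \<subseteq> I" by (auto simp: C_def)
  \<comment> \<open>Correct minus wrong answers. Below, \<open>f\<close>, negated on accepted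
    inputs, is 1 on correct and -1 on wrong ones.\<close>
  have "2 * real (card C) - real (card I) = (\<Sum>\<iota>\<in>I. if \<iota> \<in> C then 1 else - 1)"
  proof -
    have "card I = card C + card (I - C)"
      using fI CI by (simp add: card_Diff_subset card_mono finite_subset)
    then show ?thesis using fI by (simp add: sum.If_cases inf.absorb2[OF CI] flip: Diff_eq)
  qed
  also have "\<dots> \<le> (\<Sum>\<iota>\<in>I. f \<iota> - 2 * (if acc \<iota> then f \<iota> else 0))"
    by (rule sum_mono) (auto simp: f_def C_def)
  also have "\<dots> = sum f I - 2 * sum f {\<iota> \<in> I. acc \<iota>}"
    using fI by (simp add: sum_subtractf sum.If_cases Int_def flip: sum_distrib_left)
  also have "\<dots> \<le> M + 2 * (2 ^ X * M)" using acc_le all_le by linarith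
  also have "\<dots> \<le> 3 * (2 ^ X * M)"
    using mult_right_mono[of 1 "2 ^ X" M] by (simp add: M_def)
  \<comment> \<open>The left side is at least \<open>2 * 7 / 8 - 1 = 3 / 4\<close> of
    \<open>4 ^ m\<close>, and the 3 cancels.\<close>
  finally have "4 ^ m \<le> 4 * (2 ^ X * M)" using correct by (simp add: cI C_def)
  then have "((4::real) ^ m)\<^sup>2 \<le> (4 * (2 ^ X * M))\<^sup>2" by (intro power_mono) auto
  moreover have "((4::real) ^ m)\<^sup>2 = 2 ^ (4 * m)"
    by (simp add: power_mult[symmetric] power2_eq_square power_mult flip: power_mult_distrib)
  moreover have "(4 * (2 ^ X * M))\<^sup>2 = 2 ^ (4 + 2 * X + 3 * m)"
    by (simp add: M_def power_mult_distrib power_add power_mult[symmetric] mult.commute)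
  ultimately have "(2::real) ^ (4 * m) \<le> 2 ^ (4 + 2 * X + 3 * m)" by simp
  then have "4 * m \<le> 4 + 2 * X + 3 * m" by (subst (asm) power_increasing_iff) auto
  then show ?thesis by simp
qed

section \<open>Derandomization\<close>

lemma expectation_le_at_some_point:
  fixes h :: "'a \<Rightarrow> real"
  assumes "\<And>x. \<bar>h x\<bar> \<le> c"
  shows "\<exists>x\<in>set_pmf p. measure_pmf.expectation p h \<le> h x"
proof (rule ccontr)
  assume "\<not> ?thesis"
  then have lt: "h x < measure_pmf.expectation p h" if "x \<in> set_pmf p" for x using that by auto
  have int: "integrable (measure_pmf p) h"
    using assms by (intro measure_pmf.integrable_const_bound[where B = c]) auto
  have "measure_pmf.expectation p h < measure_pmf.expectation p h"
    using measure_pmf.integral_less_AE_space[OF int, of "\<lambda>_. measure_pmf.expectation p h"] lt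
    by (simp add: AE_measure_pmf_iff)
  then show False by simp
qed

text \<open>Distinct positions of a table of independent entries are independent. The random table
  below has more positions than there are vertices.\<close>

lemma Pi_pmf_reindex:
  assumes "finite V" "inj_on g V"
  shows "map_pmf (\<lambda>\<omega> v. if v \<in> V then \<omega> (g v) else z) (Pi_pmf (g ` V) z p)
    = Pi_pmf V z (\<lambda>v. p (g v))"
  using assms
proof (induction V rule: finite_induct)
  case empty
  then show ?case by simp
next
  case (insert x V)
  let ?r = "\<lambda>\<omega> v. if v \<in> V then \<omega> (g v) else z"
  have gx: "g x \<notin> g ` V" using insert by auto
  then have gv: "g v \<noteq> g x" if "v \<in> V" for v using that by (metis imageI)
  have "map_pmf (\<lambda>\<omega> v. if v \<in> insert x V then \<omega> (g v) else z) (Pi_pmf (g ` insert x V) z p)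
      = map_pmf (\<lambda>p. (\<lambda>v. if v \<in> insert x V then fun_upd (snd p) (g x) (fst p) (g v) else z))
          (pair_pmf (p (g x)) (Pi_pmf (g ` V) z p))"
    using insert.hyps gx by (simp add: Pi_pmf_insert map_pmf_comp case_prod_unfold)
  also have "\<dots> = map_pmf (\<lambda>p. fun_upd (?r (snd p)) x (fst p)) (pair_pmf (p (g x)) (Pi_pmf (g ` V) z p))"
    using insert.hyps gv by (intro map_pmf_cong refl) (auto simp: fun_eq_iff)
  also have "\<dots> = Pi_pmf (insert x V) z (\<lambda>v. p (g v))"
    using insert by (simp add: Pi_pmf_insert pair_map_pmf2 map_pmf_comp case_prod_unfold
        flip: insert.IH)
  finally show ?case .
qed

text \<open>All the distributions are realised on one random table indexed by vertex and local view,
  so that equal views at a vertex draw the same value.\<close>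

lemma consistent_choice:
  fixes z :: 'a and f :: "'v \<Rightarrow> 'k \<Rightarrow> 'a pmf" and h :: "'i \<Rightarrow> ('v \<Rightarrow> 'a) \<Rightarrow> real" and \<kappa> :: "'i \<Rightarrow> 'v \<Rightarrow> 'k"
  assumes I: "finite I" and V: "finite V" and h: "\<And>\<iota> x. \<bar>h \<iota> x\<bar> \<le> 1"
  defines "p \<equiv> (\<lambda>\<iota>. Pi_pmf V z (\<lambda>v. f v (\<kappa> \<iota> v)))"
  shows "\<exists>d. (\<forall>\<iota>\<in>I. d \<iota> \<in> set_pmf (p \<iota>)) \<and>
    (\<forall>\<iota>\<in>I. \<forall>\<iota>'\<in>I. \<forall>v\<in>V. \<kappa> \<iota> v = \<kappa> \<iota>' v \<longrightarrow> d \<iota> v = d \<iota>' v) \<and>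
    (\<Sum>\<iota>\<in>I. measure_pmf.expectation (p \<iota>) (h \<iota>)) \<le> (\<Sum>\<iota>\<in>I. h \<iota> (d \<iota>))"
proof -
  define K where "K = (\<lambda>(\<iota>, v). (v, \<kappa> \<iota> v)) ` (I \<times> V)"
  define \<Omega> where "\<Omega> = Pi_pmf K z (\<lambda>(v, k). f v k)"
  define d where "d \<omega> \<iota> v = (if v \<in> V then \<omega> (v, \<kappa> \<iota> v) else z)" for \<omega> \<iota> v
  have fK: "finite K" unfolding K_def using I V by auto
  have p: "p \<iota> = map_pmf (\<lambda>\<omega>. d \<omega> \<iota>) \<Omega>" if "\<iota> \<in> I" for \<iota>
  proof -
    \<comment> \<open>For a single input, different vertices read different entries, so the marginal
      is the prescribed product. Correlation between inputs is harmless, since only a sum of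
      expectations is compared.\<close>
    define K' where "K' = (\<lambda>v. (v, \<kappa> \<iota> v)) ` V"
    have sub: "K' \<subseteq> K" unfolding K'_def K_def using that by auto
    have "map_pmf (\<lambda>\<omega>. d \<omega> \<iota>) \<Omega> = map_pmf (\<lambda>g v. if v \<in> V then g (v, \<kappa> \<iota> v) else z)
        (map_pmf (\<lambda>g x. if x \<in> K' then g x else z) \<Omega>)"
      unfolding map_pmf_comp
      by (intro map_pmf_cong refl) (auto simp: d_def K'_def fun_eq_iff)
    also have "map_pmf (\<lambda>g x. if x \<in> K' then g x else z) \<Omega> = Pi_pmf K' z (\<lambda>(v, k). f v k)"
      unfolding \<Omega>_def using Pi_pmf_subset[OF fK sub] by metis
    also have "map_pmf (\<lambda>g v. if v \<in> V then g (v, \<kappa> \<iota> v) else z) \<dots> = p \<iota>"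
      unfolding p_def K'_def using V
      by (subst Pi_pmf_reindex) (auto simp: inj_on_def)
    finally show ?thesis by simp
  qed
  have int: "integrable (measure_pmf \<Omega>) (\<lambda>\<omega>. h \<iota> (d \<omega> \<iota>))" for \<iota>
    using h by (intro measure_pmf.integrable_const_bound[where B = 1]) auto
  have "(\<Sum>\<iota>\<in>I. measure_pmf.expectation (p \<iota>) (h \<iota>))
      = (\<Sum>\<iota>\<in>I. measure_pmf.expectation \<Omega> (\<lambda>\<omega>. h \<iota> (d \<omega> \<iota>)))"
    by (intro sum.cong refl) (simp add: p)
  also have "\<dots> = measure_pmf.expectation \<Omega> (\<lambda>\<omega>. \<Sum>\<iota>\<in>I. h \<iota> (d \<omega> \<iota>))"
    by (rule Bochner_Integration.integral_sum[symmetric]) (rule int)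
  finally have eq: "(\<Sum>\<iota>\<in>I. measure_pmf.expectation (p \<iota>) (h \<iota>)) = \<dots>" .
  have bound: "\<bar>\<Sum>\<iota>\<in>I. h \<iota> (d \<omega> \<iota>)\<bar> \<le> real (card I)" for \<omega>
  proof -
    have "\<bar>\<Sum>\<iota>\<in>I. h \<iota> (d \<omega> \<iota>)\<bar> \<le> (\<Sum>\<iota>\<in>I. \<bar>h \<iota> (d \<omega> \<iota>)\<bar>)" by (rule sum_abs)
    also have "\<dots> \<le> (\<Sum>\<iota>\<in>I. 1)" by (intro sum_mono h)
    finally show ?thesis by simp
  qed
  obtain \<omega> where \<omega>: "\<omega> \<in> set_pmf \<Omega>" and le: "measure_pmf.expectation \<Omega>
      (\<lambda>\<omega>. \<Sum>\<iota>\<in>I. h \<iota> (d \<omega> \<iota>)) \<le> (\<Sum>\<iota>\<in>I. h \<iota> (d \<omega> \<iota>))"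
    using expectation_le_at_some_point[where h = "\<lambda>\<omega>. \<Sum>\<iota>\<in>I. h \<iota> (d \<omega> \<iota>)", OF bound] by blast
  show ?thesis
  proof (intro exI[of _ "d \<omega>"] conjI ballI impI)
    show "d \<omega> \<iota> \<in> set_pmf (p \<iota>)" if "\<iota> \<in> I" for \<iota> using \<omega> by (simp add: p[OF that])
    show "d \<omega> \<iota> v = d \<omega> \<iota>' v" if "\<kappa> \<iota> v = \<kappa> \<iota>' v" for \<iota> \<iota>' v using that by (simp add: d_def)
  qed (use le eq in simp)
qed

section \<open>Fixing the random choices along an execution\<close>

definition advance :: "algorithm \<Rightarrow> network \<Rightarrow> (nat \<Rightarrow> state) \<Rightarrow> (nat \<Rightarrow> state) pmf" where
  "advance A G cfg = Pi_pmf (verts G) 0 (\<lambda>v. step A (cfg v) (inbox A G cfg v))"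

text \<open>\<open>run\<close> splits off the last round. Conditioning the success probability on
  the current configuration requires splitting off the first.\<close>

primrec run_from :: "algorithm \<Rightarrow> network \<Rightarrow> nat \<Rightarrow> (nat \<Rightarrow> state) \<Rightarrow> (nat \<Rightarrow> state) pmf" where
  "run_from A G 0 = return_pmf"
| "run_from A G (Suc r) = (\<lambda>cfg. bind_pmf (advance A G cfg) (run_from A G r))"

lemma run_add: "run A G (t + r) = bind_pmf (run A G t) (run_from A G r)"
proof (induction r arbitrary: t)
  case 0
  then show ?case by (simp add: bind_return_pmf')
next
  case (Suc r)
  have "run A G (t + Suc r) = run A G (Suc t + r)" by simp
  also have "\<dots> = bind_pmf (run A G (Suc t)) (run_from A G r)" by (rule Suc)
  also have "\<dots> = bind_pmf (run A G t) (run_from A G (Suc r))"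
    by (simp add: bind_assoc_pmf advance_def)
  finally show ?case .
qed

lemma prob_bind_pmf:
  "measure_pmf.prob (bind_pmf p f) S = measure_pmf.expectation p (\<lambda>x. measure_pmf.prob (f x) S)"
proof -
  have "emeasure (measure_pmf (bind_pmf p f)) S
      = (\<integral>\<^sup>+x. ennreal (measure_pmf.prob (f x) S) \<partial>measure_pmf p)"
    by (simp add: measure_pmf.emeasure_eq_measure[symmetric])
  also have "\<dots> = ennreal (measure_pmf.expectation p (\<lambda>x. measure_pmf.prob (f x) S))"
    by (intro nn_integral_eq_integral measure_pmf.integrable_const_bound[where B = 1]) auto
  finally show ?thesis
    by (simp add: measure_pmf.emeasure_eq_measure integral_nonneg_AE)
qed

text \<open>Method of conditional expectations, for all inputs at once: the choices of each round
  are fixed such that the sum of the conditional success probabilities does not drop. Equal local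
  views evolve equally across inputs, as for one deterministic algorithm.\<close>

lemma derandomize:
  assumes I: "finite I" and V: "finite V" and verts: "\<And>\<iota>. verts (G \<iota>) = V"
  shows "\<exists>c. (\<forall>\<iota>\<in>I. \<forall>t\<le>T. c \<iota> t \<in> set_pmf (run A (G \<iota>) t)) \<and>
    (\<forall>\<iota>\<in>I. \<forall>\<iota>'\<in>I. \<forall>v\<in>V. incident (G \<iota>) v = incident (G \<iota>') v \<longrightarrow> c \<iota> 0 v = c \<iota>' 0 v) \<and>
    (\<forall>\<iota>\<in>I. \<forall>\<iota>'\<in>I. \<forall>v\<in>V. \<forall>t<T. c \<iota> t v = c \<iota>' t v \<longrightarrow>
        inbox A (G \<iota>) (c \<iota> t) v = inbox A (G \<iota>') (c \<iota>' t) v \<longrightarrow> c \<iota> (Suc t) v = c \<iota>' (Suc t) v) \<and>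
    (\<Sum>\<iota>\<in>I. measure_pmf.prob (run A (G \<iota>) T) (S \<iota>)) \<le> real (card {\<iota> \<in> I. c \<iota> T \<in> S \<iota>})"
proof -
  define \<Theta> where "\<Theta> = (\<Sum>\<iota>\<in>I. measure_pmf.prob (run A (G \<iota>) T) (S \<iota>))"
  define h where "h r \<iota> cfg = measure_pmf.prob (run_from A (G \<iota>) r cfg) (S \<iota>)" for r \<iota> cfg
  have h1: "\<bar>h r \<iota> cfg\<bar> \<le> 1" for r \<iota> cfg by (simp add: h_def)
  define inv where "inv c t \<longleftrightarrow> (\<forall>\<iota>\<in>I. \<forall>s\<le>t. c \<iota> s \<in> set_pmf (run A (G \<iota>) s)) \<and>
    (\<forall>\<iota>\<in>I. \<forall>\<iota>'\<in>I. \<forall>v\<in>V. incident (G \<iota>) v = incident (G \<iota>') v \<longrightarrow> c \<iota> 0 v = c \<iota>' 0 v) \<and>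
    (\<forall>\<iota>\<in>I. \<forall>\<iota>'\<in>I. \<forall>v\<in>V. \<forall>s<t. c \<iota> s v = c \<iota>' s v \<longrightarrow>
        inbox A (G \<iota>) (c \<iota> s) v = inbox A (G \<iota>') (c \<iota>' s) v \<longrightarrow> c \<iota> (Suc s) v = c \<iota>' (Suc s) v) \<and>
    \<Theta> \<le> (\<Sum>\<iota>\<in>I. h (T - t) \<iota> (c \<iota> t))" for c :: "'a \<Rightarrow> nat \<Rightarrow> nat \<Rightarrow> state" and t
  have "\<exists>c. inv c t" if "t \<le> T" for t
    using that
  proof (induction t)
    case 0
    have "\<Theta> = (\<Sum>\<iota>\<in>I. measure_pmf.expectation (run A (G \<iota>) 0) (h T \<iota>))"
      unfolding \<Theta>_def h_def using run_add[of A _ 0 T] by (simp add: prob_bind_pmf)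
    moreover have "\<exists>d. (\<forall>\<iota>\<in>I. d \<iota> \<in> set_pmf (run A (G \<iota>) 0)) \<and>
      (\<forall>\<iota>\<in>I. \<forall>\<iota>'\<in>I. \<forall>v\<in>V. incident (G \<iota>) v = incident (G \<iota>') v \<longrightarrow> d \<iota> v = d \<iota>' v) \<and>
      (\<Sum>\<iota>\<in>I. measure_pmf.expectation (run A (G \<iota>) 0) (h T \<iota>)) \<le> (\<Sum>\<iota>\<in>I. h T \<iota> (d \<iota>))"
      unfolding run.simps verts
      by (rule consistent_choice[OF I V, where h = "h T" and f = "init A", OF h1])
    ultimately obtain d where "\<forall>\<iota>\<in>I. d \<iota> \<in> set_pmf (run A (G \<iota>) 0)"
      "\<forall>\<iota>\<in>I. \<forall>\<iota>'\<in>I. \<forall>v\<in>V. incident (G \<iota>) v = incident (G \<iota>') v \<longrightarrow> d \<iota> v = d \<iota>' v"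
      "\<Theta> \<le> (\<Sum>\<iota>\<in>I. h T \<iota> (d \<iota>))"
      by metis
    then have "inv (\<lambda>\<iota> _. d \<iota>) 0"
      unfolding inv_def le_zero_eq not_less_zero minus_nat.diff_0 by blast
    then show ?case by blast
  next
    case (Suc t)
    then obtain c where c: "inv c t" by auto
    have T: "T - t = Suc (T - Suc t)" using Suc.prems by simp
    have "\<Theta> \<le> (\<Sum>\<iota>\<in>I. h (T - t) \<iota> (c \<iota> t))" using c by (simp add: inv_def)
    also have "\<dots> = (\<Sum>\<iota>\<in>I. measure_pmf.expectation (advance A (G \<iota>) (c \<iota> t)) (h (T - Suc t) \<iota>))"
      unfolding h_def T by (simp add: prob_bind_pmf)
    finally have le: "\<Theta> \<le> \<dots>" .
    \<comment> \<open>The view in a later round is the state together with the inbox; in round 0 it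
      was the incident weights.\<close>
    have "\<exists>d. (\<forall>\<iota>\<in>I. d \<iota> \<in> set_pmf (advance A (G \<iota>) (c \<iota> t))) \<and>
      (\<forall>\<iota>\<in>I. \<forall>\<iota>'\<in>I. \<forall>v\<in>V. (c \<iota> t v, inbox A (G \<iota>) (c \<iota> t) v) = (c \<iota>' t v, inbox A (G \<iota>') (c \<iota>' t) v)
        \<longrightarrow> d \<iota> v = d \<iota>' v) \<and>
      (\<Sum>\<iota>\<in>I. measure_pmf.expectation (advance A (G \<iota>) (c \<iota> t)) (h (T - Suc t) \<iota>))
        \<le> (\<Sum>\<iota>\<in>I. h (T - Suc t) \<iota> (d \<iota>))"
      using consistent_choice[OF I V, where h = "h (T - Suc t)" and f = "\<lambda>v (s, m). step A s m"
          and z = 0 and \<kappa> = "\<lambda>\<iota> v. (c \<iota> t v, inbox A (G \<iota>) (c \<iota> t) v)", OF h1]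
      unfolding advance_def verts prod.case .
    then obtain d where d1: "\<forall>\<iota>\<in>I. d \<iota> \<in> set_pmf (advance A (G \<iota>) (c \<iota> t))"
      and d2: "\<forall>\<iota>\<in>I. \<forall>\<iota>'\<in>I. \<forall>v\<in>V. (c \<iota> t v, inbox A (G \<iota>) (c \<iota> t) v)
          = (c \<iota>' t v, inbox A (G \<iota>') (c \<iota>' t) v) \<longrightarrow> d \<iota> v = d \<iota>' v"
      and d3: "\<Theta> \<le> (\<Sum>\<iota>\<in>I. h (T - Suc t) \<iota> (d \<iota>))"
      using le order_trans by blast
    define c' where "c' \<iota> s = (if s \<le> t then c \<iota> s else d \<iota>)" for \<iota> s
    have "d \<iota> \<in> set_pmf (run A (G \<iota>) (Suc t))" if "\<iota> \<in> I" for \<iota>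
      using d1 c that by (auto simp: inv_def advance_def)
    then have "c' \<iota> s \<in> set_pmf (run A (G \<iota>) s)" if "\<iota> \<in> I" "s \<le> Suc t" for \<iota> s
      using that c unfolding inv_def c'_def by (cases "s \<le> t") (auto simp: not_le le_Suc_eq)
    moreover have "c' \<iota> 0 v = c' \<iota>' 0 v"
      if "\<iota> \<in> I" "\<iota>' \<in> I" "v \<in> V" "incident (G \<iota>) v = incident (G \<iota>') v" for \<iota> \<iota>' v
    proof -
      have "c \<iota> 0 v = c \<iota>' 0 v" using that c unfolding inv_def by blast
      then show ?thesis by (simp add: c'_def)
    qed
    moreover have "c' \<iota> (Suc s) v = c' \<iota>' (Suc s) v"
      if "\<iota> \<in> I" "\<iota>' \<in> I" "v \<in> V" "s < Suc t" "c' \<iota> s v = c' \<iota>' s v"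
        "inbox A (G \<iota>) (c' \<iota> s) v = inbox A (G \<iota>') (c' \<iota>' s) v" for \<iota> \<iota>' v s
    proof (cases "s = t")
      case True
      then have "d \<iota> v = d \<iota>' v" using d2[rule_format, OF that(1-3)] that(5,6) by (simp add: c'_def)
      then show ?thesis using True by (simp add: c'_def)
    next
      case False
      then have s: "s < t" using that by simp
      then have "c \<iota> s v = c \<iota>' s v" "inbox A (G \<iota>) (c \<iota> s) v = inbox A (G \<iota>') (c \<iota>' s) v"
        using that(5,6) by (simp_all add: c'_def)
      then have "c \<iota> (Suc s) v = c \<iota>' (Suc s) v"
        using c that(1-3) s unfolding inv_def by blast
      then show ?thesis using s by (simp add: c'_def)
    qed
    moreover have "\<Theta> \<le> (\<Sum>\<iota>\<in>I. h (T - Suc t) \<iota> (c' \<iota> (Suc t)))" using d3 by (simp add: c'_def)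
    ultimately have "inv c' (Suc t)" unfolding inv_def by blast
    then show ?case by blast
  qed
  then obtain c where c: "inv c T" by blast
  have "(\<Sum>\<iota>\<in>I. h 0 \<iota> (c \<iota> T)) = (\<Sum>\<iota>\<in>I. if c \<iota> T \<in> S \<iota> then 1 else 0)"
    by (intro sum.cong refl) (simp add: h_def indicator_def)
  also have "\<dots> = real (card {\<iota> \<in> I. c \<iota> T \<in> S \<iota>})"
    using I by (simp add: sum.If_cases Int_def)
  finally have "\<Theta> \<le> real (card {\<iota> \<in> I. c \<iota> T \<in> S \<iota>})" using c by (simp add: inv_def)
  then show ?thesis using c unfolding inv_def \<Theta>_def by blast
qed

text \<open>Irrevocable outputs make solved configurations absorbing. \<open>rounds\<close> is the
  first successful time of a single network, whereas the argument below needs a common time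
  \<open>T\<close> for all inputs.\<close>

lemma solved_whp_by_Suc:
  assumes irr: "irrevocable A" and fin: "finite (verts G)" and t: "solved_whp_by \<gamma> k \<alpha> A G t"
  shows "solved_whp_by \<gamma> k \<alpha> A G (Suc t)"
proof -
  let ?S = "{cfg. solved k \<alpha> A G cfg}"
  have keep: "measure_pmf.prob (advance A G cfg) ?S = 1" if sol: "solved k \<alpha> A G cfg" for cfg
  proof -
    have "solved k \<alpha> A G cfg'" if "cfg' \<in> set_pmf (advance A G cfg)" for cfg'
    proof -
      have "cfg' v \<in> set_pmf (step A (cfg v) (inbox A G cfg v))" if "v \<in> verts G" for v
        using \<open>cfg' \<in> _\<close> that fin by (auto simp: advance_def set_Pi_pmf PiE_dflt_def)
      then show ?thesis using sol irr unfolding solved_def irrevocable_def by metis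
    qed
    then show ?thesis by (subst measure_pmf.prob_eq_1) (auto simp: AE_measure_pmf_iff)
  qed
  have "measure_pmf.prob (run A G t) ?S = measure_pmf.expectation (run A G t) (indicator ?S)"
    by simp
  also have "\<dots> \<le> measure_pmf.expectation (run A G t) (\<lambda>cfg. measure_pmf.prob (advance A G cfg) ?S)"
    using keep by (intro integral_mono measure_pmf.integrable_const_bound[where B = 1])
      (auto simp: indicator_def)
  also have "\<dots> = measure_pmf.prob (run A G (Suc t)) ?S"
    by (simp add: prob_bind_pmf advance_def)
  finally show ?thesis using t by (simp add: solved_whp_by_def)
qed

lemma solved_whp_by_mono:
  assumes "irrevocable A" "finite (verts G)" "solved_whp_by \<gamma> k \<alpha> A G t" "t \<le> t'"
  shows "solved_whp_by \<gamma> k \<alpha> A G t'"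
  using assms(4,3) by (induction rule: dec_induct) (auto intro: solved_whp_by_Suc assms)

section \<open>Blow-ups of graphs\<close>

definition blowup :: "nat \<Rightarrow> (nat \<Rightarrow> 'p) \<Rightarrow> ('p \<Rightarrow> 'p \<Rightarrow> bool) \<Rightarrow> nat set set" where
  "blowup n \<phi> Q = {{u, v} | u v. u < n \<and> v < n \<and> u \<noteq> v \<and> Q (\<phi> u) (\<phi> v)}"

lemma doubleton_in_blowup:
  assumes "symp Q"
  shows "{u, v} \<in> blowup n \<phi> Q \<longleftrightarrow> u < n \<and> v < n \<and> u \<noteq> v \<and> Q (\<phi> u) (\<phi> v)"
  using assms by (auto simp: blowup_def doubleton_eq_iff dest: sympD)

lemma finite_blowup: "finite (blowup n \<phi> Q)"
  by (rule finite_subset[of _ "Pow {..<n}"]) (auto simp: blowup_def)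

lemma simple_graph_blowup: "simple_graph {..<n} (blowup n \<phi> Q)"
  by (auto simp: simple_graph_def blowup_def)

lemma symp_adj: "symp (adj E)"
  by (auto simp: symp_def adj_def insert_commute)

text \<open>The detours from \<open>u\<close> via \<open>w\<close> to \<open>v\<close> are
  edge-disjoint for different \<open>w\<close>; otherwise \<open>g\<close> would choose a different
  deleted edge for each \<open>w\<close>.\<close>

lemma surviving_common_neighbour:
  assumes F: "finite F" "card F < k" and W: "k \<le> card W" "u \<notin> W" "v \<notin> W"
  shows "\<exists>w\<in>W. {u, w} \<notin> F \<and> {w, v} \<notin> F"
proof (rule ccontr)
  assume "\<not> ?thesis"
  then have bad: "{u, w} \<in> F \<or> {w, v} \<in> F" if "w \<in> W" for w using that by blast
  define g where "g w = (if {u, w} \<in> F then {u, w} else {w, v})" for w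
  have "inj_on g W"
  proof (rule inj_onI)
    fix w w' assume "w \<in> W" "w' \<in> W" and eq: "g w = g w'"
    have "w \<in> g w" "g w' \<subseteq> {u, v, w'}" by (auto simp: g_def)
    then have "w \<in> {u, v, w'}" using eq by auto
    then show "w = w'" using W \<open>w \<in> W\<close> by auto
  qed
  moreover have "g ` W \<subseteq> F" using bad by (auto simp: g_def)
  ultimately have "card W \<le> card F" using F(1) by (rule card_inj_on_le)
  then show False using F W by simp
qed

text \<open>An edge with an end in a big fibre has \<open>k\<close> detours through that fibre: this
  is the origin of \<open>k + 2\<close>, as the two end vertices have to be set aside. Hence each
  step of a walk needs a big end.\<close>

lemma k_edge_connected_blowup:
  assumes Q: "symp Q" and \<phi>: "\<phi> ` {..<n} = N"
    and big: "\<And>p. p \<in> N \<Longrightarrow> big p \<Longrightarrow> Q p p \<and> k + 2 \<le> card {v. v < n \<and> \<phi> v = p}"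
    and small: "\<And>u v. u < n \<Longrightarrow> v < n \<Longrightarrow> \<phi> u = \<phi> v \<Longrightarrow> \<not> big (\<phi> u) \<Longrightarrow> u = v"
    and conn: "\<And>p q. p \<in> N \<Longrightarrow> q \<in> N \<Longrightarrow>
      (\<lambda>p q. p \<in> N \<and> q \<in> N \<and> Q p q \<and> (big p \<or> big q))\<^sup>*\<^sup>* p q"
  shows "k_edge_connected k {..<n} (blowup n \<phi> Q)"
  unfolding k_edge_connected_def
proof (intro allI impI)
  fix F assume "F \<subseteq> blowup n \<phi> Q" and F: "finite F \<and> card F < k"
  let ?E = "blowup n \<phi> Q - F"
  note edge = doubleton_in_blowup[OF Q]
  have big_case: "(adj ?E)\<^sup>*\<^sup>* u v"
    if "u < n" "v < n" "Q (\<phi> u) (\<phi> v)" "big (\<phi> u)" for u v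
  proof -
    define W where "W = {w. w < n \<and> \<phi> w = \<phi> u} - {u, v}"
    have "k + 2 \<le> card {w. w < n \<and> \<phi> w = \<phi> u}" using big that \<phi> by blast
    moreover have "card {w. w < n \<and> \<phi> w = \<phi> u} - card {u, v} \<le> card W"
      unfolding W_def by (rule diff_card_le_card_Diff) simp
    moreover have "card {u, v} \<le> 2" by (simp add: card_insert_if)
    ultimately have "k \<le> card W" by linarith
    moreover have "u \<notin> W" "v \<notin> W" by (auto simp: W_def)
    ultimately obtain w where w: "w \<in> W" "{u, w} \<notin> F" "{w, v} \<notin> F"
      using surviving_common_neighbour[of F k W u v] F by blast
    have "Q (\<phi> u) (\<phi> u)" using big that \<phi> by blast
    then have "adj ?E u w" "adj ?E w v" using w that by (auto simp: adj_def edge W_def)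
    then show ?thesis by (metis converse_rtranclp_into_rtranclp r_into_rtranclp)
  qed
  have sym: "(adj ?E)\<^sup>*\<^sup>* u v \<Longrightarrow> (adj ?E)\<^sup>*\<^sup>* v u" for u v
    by (rule sympD[OF symp_rtranclp[OF symp_adj]])
  have step_conn: "(adj ?E)\<^sup>*\<^sup>* u v"
    if "u < n" "v < n" "Q (\<phi> u) (\<phi> v)" "big (\<phi> u) \<or> big (\<phi> v)" for u v
    using that big_case[of u v] sym[OF big_case[of v u]] sympD[OF Q] by blast
  have walk: "(adj ?E)\<^sup>*\<^sup>* u v"
    if "(\<lambda>p q. p \<in> N \<and> q \<in> N \<and> Q p q \<and> (big p \<or> big q))\<^sup>*\<^sup>* p q"
      "u < n" "v < n" "\<phi> u = p" "\<phi> v = q" for p q u v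
    using that
  proof (induction arbitrary: v rule: rtranclp_induct)
    case base
    show ?case
    proof (cases "big p")
      case True
      then show ?thesis using base big[of p] \<phi> by (intro step_conn) auto
    next
      case False
      then show ?thesis using base small[of u v] by auto
    qed
  next
    case (step q r)
    obtain v' where "v' < n" "\<phi> v' = q" using step.hyps \<phi> by auto
    then show ?case using step.IH[of v'] step.prems step.hyps step_conn[of v' v]
      by (auto intro: rtranclp_trans)
  qed
  show "connected_graph {..<n} ?E"
    unfolding connected_graph_def using walk conn \<phi> by blast
qed

section \<open>Diameter of a blow-up\<close>

lemma diam_eqI:
  assumes "finite V" and le: "\<And>u v. u \<in> V \<Longrightarrow> v \<in> V \<Longrightarrow> \<exists>d\<le>D. (adj E ^^ d) u v"
    and uv: "u \<in> V" "v \<in> V" "\<And>d. (adj E ^^ d) u v \<Longrightarrow> D \<le> d"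
  shows "diam V E = D"
proof -
  have *: "hop_dist E a b \<le> D" if "a \<in> V" "b \<in> V" for a b
    using le[OF that] unfolding hop_dist_def by (meson Least_le order_trans)
  have "D \<le> hop_dist E u v"
    unfolding hop_dist_def using le[OF uv(1,2)] uv(3) by (metis LeastI)
  then have "hop_dist E u v = D" using *[OF uv(1,2)] by simp
  moreover have "finite {hop_dist E u v | u v. u \<in> V \<and> v \<in> V}"
    using assms(1) by (simp add: finite_image_set2)
  ultimately show ?thesis
    unfolding diam_def using * uv by (intro Max_eqI) auto
qed

lemma relpowp_symp:
  assumes "symp R" "(R ^^ d) p q"
  shows "(R ^^ d) q p"
  using assms(2)
proof (induction d arbitrary: q)
  case (Suc d)
  then obtain r where "(R ^^ d) p r" "R r q" by auto
  then show ?case using Suc.IH[of r] assms(1) by (metis relpowp_Suc_I2 sympD)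
qed simp

lemma relpowp_pad:
  assumes "(R ^^ d) p q" "d \<le> d'" "R q q"
  shows "(R ^^ d') p q"
  using assms(2,1) by (induction rule: dec_induct) (auto intro: relpowp_Suc_I assms)

lemma relpowp_mono_rel:
  fixes R S :: "'a \<Rightarrow> 'a \<Rightarrow> bool"
  assumes "(R ^^ d) p q" "\<And>p q. R p q \<Longrightarrow> S p q"
  shows "(S ^^ d) p q"
  using assms(1)
proof (induction d arbitrary: q)
  case (Suc d)
  then obtain r where "(R ^^ d) p r" "R r q" by auto
  then show ?case using Suc.IH[of r] assms(2) by (auto intro: relpowp_Suc_I)
qed simp

text \<open>Reflexivity of \<open>Q\<close> pads every walk to length exactly \<open>D\<close>.
  Walks of positive length lift and project without loss; only distinct vertices of one fibre are at
  distance 1 instead of 0, hence \<open>D \<ge> 1\<close>.\<close>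

lemma diam_blowup:
  assumes Q: "symp Q" "\<And>p. p \<in> N \<Longrightarrow> Q p p" and \<phi>: "\<phi> ` {..<n} = N" and "D \<ge> 1"
  defines "R \<equiv> (\<lambda>p q. p \<in> N \<and> q \<in> N \<and> Q p q)"
  assumes le: "\<And>p q. p \<in> N \<Longrightarrow> q \<in> N \<Longrightarrow> (R ^^ D) p q"
    and pq: "p \<in> N" "q \<in> N" "\<not> (R ^^ (D - 1)) p q"
  shows "diam {..<n} (blowup n \<phi> Q) = D"
proof -
  let ?E = "blowup n \<phi> Q"
  note edge = doubleton_in_blowup[OF Q(1)]
  have one: "\<exists>d\<le>1. (adj ?E ^^ d) u v" if "u < n" "v < n" "Q (\<phi> u) (\<phi> v)" for u v
  proof (cases "u = v")
    case True
    then show ?thesis by (intro exI[of _ 0]) simp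
  next
    case False
    then show ?thesis using that by (intro exI[of _ 1]) (simp add: adj_def edge eq_OO)
  qed
  have lift: "\<exists>d'\<le>max 1 d. (adj ?E ^^ d') u v"
    if "(R ^^ d) p q" "u < n" "v < n" "\<phi> u = p" "\<phi> v = q" for d p q u v
    using that
  proof (induction d arbitrary: p u)
    case 0
    then show ?case using one[of u v] Q \<phi> by auto
  next
    case (Suc d)
    then obtain p' where p': "R p p'" "(R ^^ d) p' q" using relpowp_Suc_D2 by metis
    show ?case
    proof (cases "d = 0")
      case True
      then show ?thesis using p' Suc.prems one[of u v] by (auto simp: R_def)
    next
      case False
      obtain u' where u': "u' < n" "\<phi> u' = p'" using p' \<phi> by (auto simp: R_def)
      obtain d' where d': "d' \<le> d" "(adj ?E ^^ d') u' v"
        using Suc.IH[OF p'(2) u'(1) _ u'(2)] Suc.prems False by auto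
      obtain d1 where "d1 \<le> 1" "(adj ?E ^^ d1) u u'"
        using one[of u u'] p' u' Suc.prems by (auto simp: R_def)
      then show ?thesis using d' by (intro exI[of _ "d1 + d'"]) (auto simp: relpowp_add)
    qed
  qed
  have project: "(R ^^ d) (\<phi> u) (\<phi> v)" if "(adj ?E ^^ d) u v" for d u v
    using that
  proof (induction d arbitrary: v)
    case (Suc d)
    then obtain w where "(adj ?E ^^ d) u w" "adj ?E w v" by auto
    moreover from this have "R (\<phi> w) (\<phi> v)" using \<phi> by (auto simp: adj_def edge R_def)
    ultimately show ?case using Suc.IH[of w] by (metis relpowp_Suc_I)
  qed simp
  obtain u v where uv: "u < n" "\<phi> u = p" "v < n" "\<phi> v = q" using pq \<phi> by auto
  show ?thesis
  proof (rule diam_eqI)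
    show "\<exists>d\<le>D. (adj ?E ^^ d) a b" if "a \<in> {..<n}" "b \<in> {..<n}" for a b
      using lift[OF le, of "\<phi> a" "\<phi> b" a b] that \<phi> \<open>D \<ge> 1\<close> by (auto simp: max_def)
    show "D \<le> d" if "(adj ?E ^^ d) u v" for d
    proof (rule ccontr)
      assume "\<not> D \<le> d"
      then have "d \<le> D - 1" by simp
      then show False
        using relpowp_pad[OF project[OF that]] pq Q uv by (auto simp: R_def)
    qed
  qed (use uv in auto)
qed

lemma ex_map_with_fibre_sizes:
  fixes N :: "'p set"
  assumes "finite N" "(\<Sum>p\<in>N. s p) = n"
  shows "\<exists>\<phi>. \<phi> ` {..<n} \<subseteq> N \<and> (\<forall>p\<in>N. card {v. v < n \<and> \<phi> v = p} = s p)"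
proof -
  let ?\<Omega> = "SIGMA p:N. {..<s p}"
  have "finite ?\<Omega>" "card ?\<Omega> = n" using assms by auto
  then obtain f where f: "bij_betw f {0..<n} ?\<Omega>" using ex_bij_betw_nat_finite by metis
  have "card {v. v < n \<and> fst (f v) = p} = s p" if "p \<in> N" for p
  proof -
    let ?F = "{v. v < n \<and> fst (f v) = p}"
    have sub: "?F \<subseteq> {0..<n}" by auto
    have img: "f ` {0..<n} = ?\<Omega>" using f by (simp add: bij_betw_def)
    have "f ` ?F = {p} \<times> {..<s p}"
    proof (intro equalityI subsetI)
      fix z assume "z \<in> f ` ?F"
      then obtain v where v: "v < n" "fst (f v) = p" "z = f v" by auto
      then have "z \<in> ?\<Omega>" using img by (metis imageI atLeastLessThan_iff zero_le)
      then show "z \<in> {p} \<times> {..<s p}" using v by auto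
    next
      fix z assume z: "z \<in> {p} \<times> {..<s p}"
      then have "z \<in> f ` {0..<n}" unfolding img using that by auto
      then obtain v where "v < n" "z = f v" by auto
      moreover from this have "v \<in> ?F" using z by auto
      ultimately show "z \<in> f ` ?F" by blast
    qed
    moreover have "card (f ` ?F) = card ?F"
      using f inj_on_subset[OF _ sub] by (intro card_image) (auto simp: bij_betw_def)
    ultimately show ?thesis by (simp add: card_cartesian_product)
  qed
  moreover have "fst (f v) \<in> N" if "v < n" for v using bij_betw_apply[OF f, of v] that by (cases "f v") auto
  then have "(fst \<circ> f) ` {..<n} \<subseteq> N" by auto
  ultimately show ?thesis by (intro exI[of _ "fst \<circ> f"]) simp
qed

section \<open>The skeleton\<close>

text \<open>The truth value selects one of the two strands. The bridges of level \<open>i\<close>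
  are a detour between the rail pairs \<open>i\<close> and \<open>i + 1\<close>, so there is one
  more pair of rails than of bridges.\<close>

datatype wire = Spine | Rail nat bool | Bridge nat bool

type_synonym node = "wire \<times> nat"

definition wires :: "nat \<Rightarrow> wire set" where
  "wires m = insert Spine ((\<lambda>(i, b). Rail i b) ` ({..m} \<times> UNIV) \<union> (\<lambda>(i, b). Bridge i b) ` ({..<m} \<times> UNIV))"

definition nodes :: "nat \<Rightarrow> nat \<Rightarrow> node set" where
  "nodes m L = wires m \<times> {..<L}"

lemma wires_iff [simp]:
  "Spine \<in> wires m" "Rail i b \<in> wires m \<longleftrightarrow> i \<le> m" "Bridge i b \<in> wires m \<longleftrightarrow> i < m"
  by (auto simp: wires_def)

lemma finite_wires [simp]: "finite (wires m)"
  by (simp add: wires_def)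

lemma finite_nodes [simp]: "finite (nodes m L)"
  by (simp add: nodes_def)

lemma card_wires: "card (wires m) \<le> 4 * m + 3"
proof -
  let ?A = "{..m} \<times> (UNIV :: bool set)" and ?B = "{..<m} \<times> (UNIV :: bool set)"
  have "card (wires m) \<le> Suc (card ((\<lambda>(i, b). Rail i b) ` ?A \<union> (\<lambda>(i, b). Bridge i b) ` ?B))"
    unfolding wires_def by (simp add: card_insert_if)
  moreover have "card ((\<lambda>(i, b). Rail i b) ` ?A \<union> (\<lambda>(i, b). Bridge i b) ` ?B)
      \<le> card ((\<lambda>(i, b). Rail i b) ` ?A) + card ((\<lambda>(i, b). Bridge i b) ` ?B)"
    by (rule card_Un_le)
  moreover have "card ((\<lambda>(i, b). Rail i b) ` ?A) \<le> card ?A" "card ((\<lambda>(i, b). Bridge i b) ` ?B) \<le> card ?B"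
    by (intro card_image_le; simp)+
  moreover have "card ?A = 2 * m + 2" "card ?B = 2 * m" by (simp_all add: card_cartesian_product)
  ultimately show ?thesis by linarith
qed

text \<open>Alignment to multiples of \<open>2 ^ e\<close> leaves at most one shortcut of each
  length across a given gap between columns. Columns from \<open>l\<close> on form a tail without
  shortcuts, whose length tunes the diameter.\<close>

definition skip :: "nat \<Rightarrow> nat \<Rightarrow> nat \<Rightarrow> bool" where
  "skip l i j \<longleftrightarrow> (\<exists>e. 2 ^ e dvd i \<and> j = i + 2 ^ e \<and> j < l)"

text \<open>\<open>x\<close> and \<open>y\<close> do not occur: all inputs share one topology and
  differ only in weights. Columns are complete, so the spine is one step away from everywhere;
  reflexivity turns fibres into cliques.\<close>

definition near :: "nat \<Rightarrow> node \<Rightarrow> node \<Rightarrow> bool" where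
  "near l p q \<longleftrightarrow> snd p = snd q \<or> (fst p = fst q \<and> (snd q = Suc (snd p) \<or> snd p = Suc (snd q))) \<or>
    (fst p = Spine \<and> fst q = Spine \<and> (skip l (snd p) (snd q) \<or> skip l (snd q) (snd p)))"

definition near_on :: "nat \<Rightarrow> nat \<Rightarrow> nat \<Rightarrow> node \<Rightarrow> node \<Rightarrow> bool" where
  "near_on m l L p q \<longleftrightarrow> p \<in> nodes m L \<and> q \<in> nodes m L \<and> near l p q"

lemma near_refl [simp]: "near l p p"
  by (simp add: near_def)

lemma symp_near: "symp (near l)"
  by (auto simp: symp_def near_def)

lemma symp_near_on: "symp (near_on m l L)"
  by (auto simp: symp_def near_on_def near_def)

section \<open>Diameter of the skeleton, by walks padded to an exact length\<close>

definition diam_le :: "nat \<Rightarrow> nat \<Rightarrow> nat \<Rightarrow> nat \<Rightarrow> bool" where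
  "diam_le m l L d \<longleftrightarrow> (\<forall>p\<in>nodes m L. \<forall>q\<in>nodes m L. (near_on m l L ^^ d) p q)"

lemma diam_le_mono: "diam_le m l L d \<Longrightarrow> d \<le> d' \<Longrightarrow> diam_le m l L d'"
  unfolding diam_le_def by (metis near_on_def near_refl relpowp_pad)

lemma diam_le_Suc:
  assumes w: "diam_le m l L d" and "L \<ge> 1"
  shows "diam_le m l (Suc L) (Suc d)"
  unfolding diam_le_def
proof (intro ballI)
  let ?R = "near_on m l (Suc L)"
  fix p q assume pq: "p \<in> nodes m (Suc L)" "q \<in> nodes m (Suc L)"
  have refl: "?R p p" if "p \<in> nodes m (Suc L)" for p using that by (simp add: near_on_def)
  have walk: "(?R ^^ d) p q" if "p \<in> nodes m L" "q \<in> nodes m L" for p q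
    by (rule relpowp_mono_rel[of _ "near_on m l L"])
      (use that w in \<open>auto simp: diam_le_def near_on_def nodes_def\<close>)
  have new: "(?R ^^ Suc d) p q" if "p \<in> nodes m L" "q \<in> nodes m (Suc L)" "snd q = L" for p q
  proof (rule relpowp_Suc_I)
    show "(?R ^^ d) p (fst q, L - 1)" using that \<open>L \<ge> 1\<close> by (intro walk) (auto simp: nodes_def)
    show "?R (fst q, L - 1) q" using that \<open>L \<ge> 1\<close> by (auto simp: near_on_def nodes_def near_def)
  qed
  have cases: "p \<in> nodes m L \<or> snd p = L" if "p \<in> nodes m (Suc L)" for p
    using that by (auto simp: nodes_def)
  have "(?R ^^ Suc d) p q" if "p \<in> nodes m L" "q \<in> nodes m L"
    using relpowp_pad[OF walk[OF that], of "Suc d"] refl[OF pq(2)] by simp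
  moreover have "(?R ^^ Suc d) p q" if "snd p = L" "snd q = L"
  proof -
    have "(?R ^^ 1) p q" using that pq by (auto simp: near_on_def near_def eq_OO)
    then show ?thesis using relpowp_pad refl[OF pq(2)] by (metis One_nat_def Suc_le_mono zero_le)
  qed
  ultimately show "(?R ^^ Suc d) p q"
    using new[of p q] relpowp_symp[OF symp_near_on new[of q p]] cases pq by blast
qed

lemma diam_le_length:
  assumes "L \<ge> 1"
  shows "diam_le m l L L"
  using assms
proof (induction L rule: dec_induct)
  case base
  show ?case by (auto simp: diam_le_def near_on_def near_def nodes_def eq_OO)
next
  case (step L)
  then show ?case by (intro diam_le_Suc) auto
qed

text \<open>The binary digits of \<open>j\<close> are read from the top: a digit 1 is one shortcut,
  a digit 0 costs at most an idle step. Aligned starting points are kept throughout.\<close>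

lemma spine_walk:
  assumes "2 ^ s dvd a" "j < 2 ^ s" "a + 2 ^ s \<le> l" "l \<le> L"
  shows "(near_on m l L ^^ s) (Spine, a) (Spine, a + j)"
  using assms
proof (induction s arbitrary: a j)
  case 0
  then show ?case by simp
next
  case (Suc s)
  let ?R = "near_on m l L"
  have dvd: "2 ^ s dvd a" using Suc.prems(1) by (metis dvd_trans le_imp_power_dvd le_SucI order_refl)
  show ?case
  proof (cases "j < 2 ^ s")
    case True
    then have "(?R ^^ s) (Spine, a) (Spine, a + j)" using Suc dvd by auto
    then show ?thesis
      by (rule relpowp_pad) (use Suc.prems in \<open>auto simp: near_on_def nodes_def\<close>)
  next
    case False
    have "skip l a (a + 2 ^ s)"
      unfolding skip_def using dvd Suc.prems by (intro exI[of _ s]) auto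
    then have "?R (Spine, a) (Spine, a + 2 ^ s)"
      using Suc.prems by (auto simp: near_on_def nodes_def near_def)
    moreover have "(?R ^^ s) (Spine, a + 2 ^ s) (Spine, a + 2 ^ s + (j - 2 ^ s))"
      using Suc.prems dvd False by (intro Suc.IH) auto
    ultimately show ?thesis using False by (metis add.assoc le_add_diff_inverse not_less relpowp_Suc_I2)
  qed
qed

text \<open>Onto the spine, to column 0, out to the target column, off the spine:
  \<open>1 + s + s + 1\<close>.\<close>

lemma diam_le_core: "diam_le m (2 ^ s) (2 ^ s) (2 * s + 2)"
  unfolding diam_le_def
proof (intro ballI)
  let ?R = "near_on m (2 ^ s) (2 ^ s)"
  fix p q assume pq: "p \<in> nodes m (2 ^ s)" "q \<in> nodes m (2 ^ s)"
  have spine: "(?R ^^ s) (Spine, 0) (Spine, j)" if "j < 2 ^ s" for j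
    using spine_walk[of s 0 j "2 ^ s" "2 ^ s" m] that by simp
  have "(?R ^^ s) (Spine, snd p) (Spine, 0)"
    using relpowp_symp[OF symp_near_on spine] pq by (auto simp: nodes_def)
  moreover have "(?R ^^ s) (Spine, 0) (Spine, snd q)" using spine pq by (auto simp: nodes_def)
  ultimately have "(?R ^^ (s + s)) (Spine, snd p) (Spine, snd q)" by (auto simp: relpowp_add)
  moreover have "?R p (Spine, snd p)" "?R (Spine, snd q) q"
    using pq by (auto simp: near_on_def nodes_def near_def)
  ultimately have "(?R ^^ Suc (Suc (s + s))) p q" by (metis relpowp_Suc_I relpowp_Suc_I2)
  then show "(?R ^^ (2 * s + 2)) p q" by (simp only: mult_2 add_2_eq_Suc')
qed

text \<open>Shortcuts end before column \<open>l\<close>, so the maximum of the column and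
  \<open>l - 1\<close> grows by at most one per step.\<close>

lemma not_diam_le:
  assumes "l \<ge> 1" "d < D"
  shows "\<not> diam_le m l (l + D) d"
proof
  assume "diam_le m l (l + D) d"
  then have walk: "(near_on m l (l + D) ^^ d) (Spine, l - 1) (Spine, l - 1 + D)"
    using assms by (auto simp: diam_le_def nodes_def)
  have "max (snd q) (l - 1) \<le> max (snd p) (l - 1) + d" if "(near_on m l (l + D) ^^ d) p q" for d p q
    using that
  proof (induction d arbitrary: q)
    case (Suc d)
    then obtain r where r: "(near_on m l (l + D) ^^ d) p r" "near_on m l (l + D) r q" by auto
    have "max (snd q) (l - 1) \<le> max (snd r) (l - 1) + 1"
      using r(2) by (auto simp: near_on_def near_def skip_def)
    then show ?case using Suc.IH[OF r(1)] by linarith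
  qed simp
  from this[OF walk] show False using assms by simp
qed

text \<open>Appending a column raises the diameter by at most one, so every diameter is attained.\<close>

lemma obtain_length:
  assumes "D \<ge> 2 * s + 2"
  obtains L where "2 ^ s \<le> L" "L \<le> 2 ^ s + D" "D \<le> L" "diam_le m (2 ^ s) L D" "\<not> diam_le m (2 ^ s) L (D - 1)"
proof -
  define P where "P L \<longleftrightarrow> 2 ^ s \<le> L \<and> \<not> diam_le m (2 ^ s) L (D - 1)" for L
  have top: "P (2 ^ s + D)" using not_diam_le[of "2 ^ s" "D - 1" D] assms by (simp add: P_def)
  define L where "L = (LEAST L. P L)"
  have PL: "P L" unfolding L_def by (rule LeastI) (rule top)
  have le: "L \<le> 2 ^ s + D" unfolding L_def by (rule Least_le) (rule top)
  have "diam_le m (2 ^ s) L D"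
  proof (cases "L = 2 ^ s")
    case True
    then show ?thesis using diam_le_mono[OF diam_le_core assms] by simp
  next
    case False
    then have "\<not> P (L - 1)" "2 ^ s \<le> L - 1"
      using not_less_Least[of "L - 1" P] PL by (auto simp: L_def P_def)
    then have "diam_le m (2 ^ s) (L - 1) (D - 1)" by (simp add: P_def)
    moreover have "1 \<le> L - 1" using \<open>2 ^ s \<le> L - 1\<close> by (metis one_le_numeral one_le_power order_trans)
    ultimately show ?thesis using diam_le_Suc[of m "2 ^ s" "L - 1" "D - 1"] assms by simp
  qed
  \<comment> \<open>For \<open>s = 0\<close>, where \<open>2 ^ s\<close> says nothing, this is what
    guarantees long paths.\<close>
  moreover have "D \<le> L"
  proof (rule ccontr)
    assume "\<not> D \<le> L"
    moreover have "L \<ge> 1" using PL by (metis P_def one_le_numeral one_le_power order_trans)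
    ultimately have "diam_le m (2 ^ s) L (D - 1)" by (intro diam_le_mono[OF diam_le_length]) auto
    then show False using PL by (simp add: P_def)
  qed
  ultimately show ?thesis using that PL le by (auto simp: P_def)
qed

section \<open>Edges of weight zero\<close>

text \<open>Level \<open>i\<close> passes the pair of rails on unchanged, except that it swaps them if
  \<open>i \<in> x \<inter> y\<close>: the bridges cross on the right if \<open>i \<in> y\<close>, but the rails are routed over them
  on the left only if \<open>i \<in> x\<close>. The rails are finally closed up by joining \<open>Rail m False\<close> to
  \<open>Rail 0 False\<close>, so that the two components merge iff the number of swaps is odd.\<close>

definition left_join :: "nat \<Rightarrow> nat set \<Rightarrow> wire \<Rightarrow> wire \<Rightarrow> bool" where
  "left_join m x w w' \<longleftrightarrow> (w = Rail m False \<and> w' = Rail 0 False) \<or>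
    (\<exists>i<m. \<exists>b. w = Rail (Suc i) b \<and> w' = (if i \<in> x then Bridge i b else Rail i b))"

definition right_join :: "nat set \<Rightarrow> wire \<Rightarrow> wire \<Rightarrow> bool" where
  "right_join y w w' \<longleftrightarrow> (\<exists>i b. w = Bridge i b \<and> w' = Rail i (b \<noteq> (i \<in> y)))"

text \<open>Every spine node is tied to the fat fibre \<open>Rail 0 False\<close> of its column,
  because an edge between two single vertices has no detours through a fibre.\<close>

definition join :: "nat \<Rightarrow> nat \<Rightarrow> nat set \<Rightarrow> nat set \<Rightarrow> node \<Rightarrow> node \<Rightarrow> bool" where
  "join m L x y p q \<longleftrightarrow> (fst p = Spine \<and> fst q = Rail 0 False) \<or>
    (snd p = 0 \<and> left_join m x (fst p) (fst q)) \<or> (snd p = L - 1 \<and> right_join y (fst p) (fst q))"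

text \<open>Edges between columns are free for every input, shortcuts included, since they stay on
  one wire. So \<open>x\<close> is visible in column 0 only and \<open>y\<close> in column
  \<open>L - 1\<close> only.\<close>

definition free :: "nat \<Rightarrow> nat \<Rightarrow> nat set \<Rightarrow> nat set \<Rightarrow> node \<Rightarrow> node \<Rightarrow> bool" where
  "free m L x y p q \<longleftrightarrow> snd p \<noteq> snd q \<or> fst p = fst q \<or> join m L x y p q \<or> join m L x y q p"

lemma symp_free: "symp (free m L x y)"
  by (auto simp: symp_def free_def)

lemma free_left: "snd p \<noteq> 0 \<Longrightarrow> snd q \<noteq> 0 \<Longrightarrow> free m L x y p q = free m L x' y p q"
  by (simp add: free_def join_def)

lemma free_right: "snd p \<noteq> L - 1 \<Longrightarrow> snd q \<noteq> L - 1 \<Longrightarrow> free m L x y p q = free m L x y' p q"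
  by (simp add: free_def join_def)

text \<open>The strand of level 0 reached by tracing a wire back: the cardinality counts the swaps
  on the way. A bridge is traced through its right end, where it is joined to a rail for every
  \<open>x\<close>.\<close>

fun label :: "nat set \<Rightarrow> nat set \<Rightarrow> wire \<Rightarrow> bool" where
  "label x y Spine = False"
| "label x y (Rail i b) = (b \<noteq> odd (card (x \<inter> y \<inter> {..<i})))"
| "label x y (Bridge i b) = ((b \<noteq> (i \<in> y)) \<noteq> odd (card (x \<inter> y \<inter> {..<i})))"

lemma odd_card_inter_Suc:
  "odd (card (z \<inter> {..<Suc i})) \<longleftrightarrow> (i \<in> z) \<noteq> odd (card (z \<inter> {..<i}))"
proof (cases "i \<in> z")
  case True
  then have "z \<inter> {..<Suc i} = insert i (z \<inter> {..<i})" by auto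
  then show ?thesis using True by simp
next
  case False
  then have "z \<inter> {..<Suc i} = z \<inter> {..<i}" by (auto simp: less_Suc_eq)
  then show ?thesis using False by simp
qed

lemma label_Rail_Suc:
  "label x y (Rail (Suc i) b) = label x y (if i \<in> x then Bridge i b else Rail i b)"
  using odd_card_inter_Suc[of "x \<inter> y" i] by (auto simp del: lessThan_Suc)

text \<open>Parity enters only at the closing join, whose two rails get the same label iff the
  number of swaps is even.\<close>

lemma label_free:
  assumes x: "x \<subseteq> {..<m}" and even: "even (card (x \<inter> y))"
    and pq: "near l p q" "free m L x y p q"
  shows "label x y (fst p) = label x y (fst q)"
proof -
  have m: "x \<inter> y \<inter> {..<m} = x \<inter> y" using x by blast
  have left: "label x y w = label x y w'" if "left_join m x w w'" for w w'
  proof -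
    have closing: "label x y (Rail m False) = label x y (Rail 0 False)" using even by (simp add: m)
    from that consider "w = Rail m False" "w' = Rail 0 False"
      | i b where "w = Rail (Suc i) b" "w' = (if i \<in> x then Bridge i b else Rail i b)"
      unfolding left_join_def by blast
    then show ?thesis by cases (simp_all only: label_Rail_Suc closing)
  qed
  have right: "label x y w = label x y w'" if "right_join y w w'" for w w'
    using that by (auto simp: right_join_def)
  have "label x y (fst p) = label x y (fst q)" if "join m L x y p q" for p q
    using that left right by (auto simp: join_def)
  from this[of p q] this[of q p] show ?thesis
    using pq by (auto simp: free_def near_def)
qed

abbreviation sturdy :: "node \<Rightarrow> bool" where
  "sturdy p \<equiv> fst p \<noteq> Spine"

definition free_step :: "nat \<Rightarrow> nat \<Rightarrow> nat \<Rightarrow> nat set \<Rightarrow> nat set \<Rightarrow> node \<Rightarrow> node \<Rightarrow> bool" where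
  "free_step m l L x y p q \<longleftrightarrow> p \<in> nodes m L \<and> q \<in> nodes m L \<and>
    (near l p q \<and> free m L x y p q) \<and> (sturdy p \<or> sturdy q)"

text \<open>Every rail traces back to level 0 on the strand given by its label. For odd parity
  \<open>Rail m False\<close> leads to \<open>Rail 0 True\<close>, while the closing join ties it to
  \<open>Rail 0 False\<close>, so the two strands merge.\<close>

lemma free_step_connected:
  assumes x: "x \<subseteq> {..<m}" and odd: "odd (card (x \<inter> y))" and L: "L \<ge> 1"
    and pq: "p \<in> nodes m L" "q \<in> nodes m L"
  shows "(free_step m l L x y)\<^sup>*\<^sup>* p q"
proof -
  let ?R = "free_step m l L x y"
  have "symp ?R"
    using symp_near symp_free by (auto simp: symp_def free_step_def)
  then have sym: "?R\<^sup>*\<^sup>* p q \<Longrightarrow> ?R\<^sup>*\<^sup>* q p" for p q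
    by (rule sympD[OF symp_rtranclp])
  have along: "?R\<^sup>*\<^sup>* (w, 0) (w, j)" if "w \<in> wires m" "w \<noteq> Spine" "j < L" for w j
    using that(3)
  proof (induction j)
    case (Suc j)
    have "?R (w, j) (w, Suc j)"
      using that Suc.prems by (auto simp: free_step_def nodes_def near_def free_def)
    then show ?case using Suc by (auto intro: rtranclp.rtrancl_into_rtrancl)
  qed simp
  have left: "?R\<^sup>*\<^sup>* (w, 0) (w', 0)"
    if "left_join m x w w'" "w \<in> wires m" "w' \<in> wires m" for w w'
    using that L by (intro r_into_rtranclp)
      (auto simp: free_step_def nodes_def near_def free_def join_def left_join_def)
  have right: "?R\<^sup>*\<^sup>* (w, 0) (w', 0)"
    if "right_join y w w'" "w \<in> wires m" "w' \<in> wires m" for w w'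
  proof -
    have "w \<noteq> Spine" "w' \<noteq> Spine" using that by (auto simp: right_join_def)
    moreover have "?R (w, L - 1) (w', L - 1)"
      using that L by (auto simp: free_step_def nodes_def near_def free_def join_def right_join_def)
    ultimately show ?thesis
      using along[of w "L - 1"] sym[OF along[of w' "L - 1"]] that L
      by (metis One_nat_def Suc_le_eq diff_less less_one rtranclp.rtrancl_into_rtrancl rtranclp_trans)
  qed
  have bridge: "?R\<^sup>*\<^sup>* (Bridge i b, 0) (Rail i (b \<noteq> (i \<in> y)), 0)" if "i < m" for i b
    using that by (intro right) (auto simp: right_join_def)
  have rail: "?R\<^sup>*\<^sup>* (Rail i b, 0) (Rail 0 (label x y (Rail i b)), 0)" if "i \<le> m" for i b
    using that
  proof (induction i arbitrary: b)
    case (Suc i)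
    then have IH: "?R\<^sup>*\<^sup>* (Rail i b, 0) (Rail 0 (label x y (Rail i b)), 0)" for b by simp
    have "?R\<^sup>*\<^sup>* (Rail (Suc i) b, 0) (if i \<in> x then Bridge i b else Rail i b, 0)"
      using Suc.prems by (intro left) (auto simp: left_join_def)
    moreover have "?R\<^sup>*\<^sup>* (if i \<in> x then Bridge i b else Rail i b, 0) (Rail 0 (label x y (Rail (Suc i) b)), 0)"
    proof (cases "i \<in> x")
      case True
      have "?R\<^sup>*\<^sup>* (Bridge i b, 0) (Rail 0 (label x y (Rail i (b \<noteq> (i \<in> y)))), 0)"
        using rtranclp_trans[OF bridge IH] Suc.prems by simp
      moreover have "label x y (Rail i (b \<noteq> (i \<in> y))) = label x y (Rail (Suc i) b)"
        using True by (subst label_Rail_Suc) simp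
      ultimately show ?thesis using True by simp
    next
      case False
      then have "label x y (Rail i b) = label x y (Rail (Suc i) b)" by (subst label_Rail_Suc) simp
      then show ?thesis using IH[of b] False by simp
    qed
    ultimately show ?case by (rule rtranclp_trans)
  qed simp
  have "x \<inter> y \<inter> {..<m} = x \<inter> y" using x by blast
  then have "?R\<^sup>*\<^sup>* (Rail m False, 0) (Rail 0 True, 0)" using rail[of m False] odd by simp
  moreover have "?R\<^sup>*\<^sup>* (Rail m False, 0) (Rail 0 False, 0)"
    by (intro left) (auto simp: left_join_def)
  ultimately have "?R\<^sup>*\<^sup>* (Rail 0 True, 0) (Rail 0 False, 0)"
    using rtranclp_trans[OF sym] by blast
  then have roots: "?R\<^sup>*\<^sup>* (Rail 0 b, 0) (Rail 0 False, 0)" for b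
    by (cases b) auto
  have rail_root: "?R\<^sup>*\<^sup>* (Rail i b, 0) (Rail 0 False, 0)" if "i \<le> m" for i b
    using rtranclp_trans[OF rail[OF that] roots] .
  have root: "?R\<^sup>*\<^sup>* (w, j) (Rail 0 False, 0)" if w: "w \<in> wires m" "j < L" for w j
  proof (cases w)
    case Spine
    have "?R (Spine, j) (Rail 0 False, j)"
      using w by (auto simp: free_step_def nodes_def near_def free_def join_def)
    then show ?thesis
      using sym[OF along[of "Rail 0 False" j]] w Spine by (auto intro: converse_rtranclp_into_rtranclp)
  next
    case (Rail i b)
    then show ?thesis using rtranclp_trans[OF sym[OF along] rail_root] w by auto
  next
    case (Bridge i b)
    then have "?R\<^sup>*\<^sup>* (w, 0) (Rail 0 False, 0)"
      using rtranclp_trans[OF bridge rail_root] w by auto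
    then show ?thesis using rtranclp_trans[OF sym[OF along]] w Bridge by auto
  qed
  show ?thesis
    using rtranclp_trans[OF root sym[OF root], of "fst p" "snd p" "fst q" "snd q"] pq
    by (auto simp: nodes_def)
qed

text \<open>The input graph must be \<open>k\<close>-edge-connected for either parity. With edges of
  weight 1 included, complete columns strung along a single rail suffice.\<close>

lemma near_step_connected:
  assumes "p \<in> nodes m L" "q \<in> nodes m L"
  shows "(\<lambda>p q. p \<in> nodes m L \<and> q \<in> nodes m L \<and> near l p q \<and> (sturdy p \<or> sturdy q))\<^sup>*\<^sup>* p q"
    (is "?R\<^sup>*\<^sup>* p q")
proof -
  have "symp ?R" using symp_near by (auto simp: symp_def)
  then have sym: "?R\<^sup>*\<^sup>* p q \<Longrightarrow> ?R\<^sup>*\<^sup>* q p" for p q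
    by (rule sympD[OF symp_rtranclp])
  have "?R\<^sup>*\<^sup>* (Rail 0 False, 0) (Rail 0 False, j)" if "j < L" for j
    using that
  proof (induction j)
    case (Suc j)
    have "?R (Rail 0 False, j) (Rail 0 False, Suc j)"
      using Suc.prems by (auto simp: nodes_def near_def)
    then show ?case using Suc by (auto intro: rtranclp.rtrancl_into_rtrancl)
  qed simp
  note rail = this
  have root: "?R\<^sup>*\<^sup>* (Rail 0 False, 0) r" if r: "r \<in> nodes m L" for r
  proof -
    have j: "snd r < L" and last: "?R (Rail 0 False, snd r) r"
      using r by (auto simp: nodes_def near_def)
    show ?thesis by (rule rtranclp.rtrancl_into_rtrancl[of ?R, OF rail[OF j] last])
  qed
  show ?thesis using rtranclp_trans[OF sym[OF root] root] assms by blast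
qed

section \<open>The hard networks\<close>

definition assignment :: "nat \<Rightarrow> nat \<Rightarrow> nat \<Rightarrow> nat \<Rightarrow> (nat \<Rightarrow> node) \<Rightarrow> bool" where
  "assignment n k m L \<phi> \<longleftrightarrow> \<phi> ` {..<n} = nodes m L \<and>
    (\<forall>p\<in>nodes m L. sturdy p \<longrightarrow> k + 2 \<le> card {v. v < n \<and> \<phi> v = p}) \<and>
    (\<forall>u<n. \<forall>v<n. \<phi> u = \<phi> v \<longrightarrow> \<not> sturdy (\<phi> u) \<longrightarrow> u = v)"

lemma ex_assignment:
  assumes n: "L * ((4 * m + 2) * (k + 2) + 1) \<le> n" and L: "L \<ge> 1"
  shows "\<exists>\<phi>. assignment n k m L \<phi>"
proof -
  let ?N = "nodes m L" and ?p0 = "(Rail 0 False, 0)"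
  define s0 where "s0 p = (if sturdy p then k + 2 else 1)" for p :: node
  have cw: "card (wires m - {Spine}) \<le> 4 * m + 2" using card_wires[of m] by simp
  have "(\<Sum>p\<in>?N. s0 p) = (\<Sum>w\<in>wires m. \<Sum>j<L. if w \<noteq> Spine then k + 2 else 1)"
    by (simp only: nodes_def s0_def sum.cartesian_product case_prod_unfold)
  also have "\<dots> = L * (\<Sum>w\<in>wires m. if w \<noteq> Spine then k + 2 else 1)"
    by (simp add: sum_distrib_left)
  also have "(\<Sum>w\<in>wires m. if w \<noteq> Spine then k + 2 else 1) = 1 + card (wires m - {Spine}) * (k + 2)"
  proof -
    have "(\<Sum>w\<in>wires m. if w \<noteq> Spine then k + 2 else 1)
        = 1 + (\<Sum>w\<in>wires m - {Spine}. if w \<noteq> Spine then k + 2 else 1)"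
      by (subst sum.remove[of _ Spine]) simp_all
    also have "(\<Sum>w\<in>wires m - {Spine}. if w \<noteq> Spine then k + 2 else 1) = (\<Sum>w\<in>wires m - {Spine}. k + 2)"
      by (rule sum.cong) auto
    finally show ?thesis by simp
  qed
  also have "L * (1 + card (wires m - {Spine}) * (k + 2)) \<le> L * ((4 * m + 2) * (k + 2) + 1)"
    using cw by (metis add.commute add_le_mono1 mult_le_mono1 mult_le_mono2)
  finally have le: "(\<Sum>p\<in>?N. s0 p) \<le> n" using n by linarith
  \<comment> \<open>One fat fibre absorbs the surplus, so the number of vertices is exactly
    \<open>n\<close>.\<close>
  define s where "s p = s0 p + (if p = ?p0 then n - (\<Sum>p\<in>?N. s0 p) else 0)" for p
  have "?p0 \<in> ?N" using L by (auto simp: nodes_def)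
  then have "(\<Sum>p\<in>?N. s p) = n" using le by (simp add: s_def sum.distrib)
  from ex_map_with_fibre_sizes[OF finite_nodes this]
  obtain \<phi> where \<phi>: "\<phi> ` {..<n} \<subseteq> ?N" "\<forall>p\<in>?N. card {v. v < n \<and> \<phi> v = p} = s p"
    by (elim exE conjE)
  note \<phi> = \<phi>(1) \<phi>(2)[rule_format]
  have "p \<in> \<phi> ` {..<n}" if "p \<in> ?N" for p
  proof -
    have "card {v. v < n \<and> \<phi> v = p} \<noteq> 0" using \<phi>(2)[OF that] by (simp add: s_def s0_def)
    then have "{v. v < n \<and> \<phi> v = p} \<noteq> {}" by (metis card.empty)
    then show ?thesis by auto
  qed
  then have "\<phi> ` {..<n} = ?N" using \<phi>(1) by blast
  moreover have "k + 2 \<le> card {v. v < n \<and> \<phi> v = p}" if "p \<in> ?N" "sturdy p" for p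
    using \<phi>(2)[OF that(1)] that(2) by (simp add: s_def s0_def)
  moreover have "u = v" if "u < n" "v < n" "\<phi> u = \<phi> v" "\<not> sturdy (\<phi> u)" for u v
  proof -
    have "\<phi> u \<in> ?N" using \<phi>(1) that(1) by auto
    then have "card {w. w < n \<and> \<phi> w = \<phi> u} = 1"
      using \<phi>(2)[of "\<phi> u"] that(4) by (auto simp: s_def s0_def)
    then obtain z where "{w. w < n \<and> \<phi> w = \<phi> u} = {z}" by (rule card_1_singletonE)
    then have "u = z" "v = z" using that by auto
    then show ?thesis by simp
  qed
  ultimately show ?thesis unfolding assignment_def by blast
qed

locale hard_network =
  fixes n k m l L :: nat and \<phi> :: "nat \<Rightarrow> node"
  assumes k: "k \<ge> 1" and L: "L \<ge> 1" and \<phi>: "assignment n k m L \<phi>"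
begin

abbreviation col :: "nat \<Rightarrow> nat" where
  "col v \<equiv> snd (\<phi> v)"

definition links :: "nat set set" where
  "links = blowup n \<phi> (near l)"

definition free_links :: "nat set \<Rightarrow> nat set \<Rightarrow> nat set set" where
  "free_links x y = blowup n \<phi> (\<lambda>p q. near l p q \<and> free m L x y p q)"

definition net :: "nat set \<Rightarrow> nat set \<Rightarrow> network" where
  "net x y = \<lparr>verts = {..<n}, edges = links,
    weight = (\<lambda>e. if \<exists>u v. e = {u, v} \<and> free m L x y (\<phi> u) (\<phi> v) then 0 else 1)\<rparr>"

lemma net_simps [simp]:
  "verts (net x y) = {..<n}" "edges (net x y) = links"
  "weight (net x y) {u, v} = (if free m L x y (\<phi> u) (\<phi> v) then 0 else 1)"
  by (auto simp: net_def doubleton_eq_iff dest: sympD[OF symp_free])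

lemma in_links: "{u, v} \<in> links \<longleftrightarrow> u < n \<and> v < n \<and> u \<noteq> v \<and> near l (\<phi> u) (\<phi> v)"
  unfolding links_def by (rule doubleton_in_blowup[OF symp_near])

lemma symp_free_near: "symp (\<lambda>p q. near l p q \<and> free m L x y p q)"
  using symp_near symp_free by (auto simp: symp_def)

lemma surj: "\<phi> ` {..<n} = nodes m L"
  using \<phi> by (simp add: assignment_def)

lemma spine_unique: "u < n \<Longrightarrow> v < n \<Longrightarrow> \<phi> u = \<phi> v \<Longrightarrow> \<not> sturdy (\<phi> u) \<Longrightarrow> u = v"
  using \<phi> unfolding assignment_def by blast

lemma fibre: "p \<in> nodes m L \<Longrightarrow> sturdy p \<Longrightarrow> k + 2 \<le> card {v. v < n \<and> \<phi> v = p}"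
  using \<phi> unfolding assignment_def by blast

lemma net_input:
  assumes "i \<ge> 1" "w \<ge> 1"
  shows "kecss_input i w k n (net x y)"
proof -
  have "(Spine, 0) \<in> \<phi> ` {..<n}" using L by (simp add: surj nodes_def)
  then obtain v where "v < n" by auto
  then have n: "n \<ge> 1" by simp
  have "n \<le> n ^ i" "1 \<le> n ^ w" using n assms by (simp_all add: self_le_power)
  then have "{..<n} \<subseteq> {..<n ^ i}" "\<forall>e\<in>links. weight (net x y) e \<le> n ^ w"
    by (auto simp: net_def)
  moreover have "k_edge_connected k {..<n} links"
    unfolding links_def
  proof (rule k_edge_connected_blowup[OF symp_near surj, where big = sturdy])
    show "near l p p \<and> k + 2 \<le> card {v. v < n \<and> \<phi> v = p}" if "p \<in> nodes m L" "sturdy p" for p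
      by (intro conjI near_refl fibre that)
  qed (use spine_unique near_step_connected in blast)+
  moreover have "simple_graph {..<n} links"
    unfolding links_def by (rule simple_graph_blowup)
  ultimately show ?thesis by (simp add: kecss_input_def)
qed

lemma hop_diameter_net:
  assumes "D \<ge> 1" "diam_le m l L D" "\<not> diam_le m l L (D - 1)"
  shows "hop_diameter (net x y) = D"
proof -
  have R: "near_on m l L = (\<lambda>p q. p \<in> nodes m L \<and> q \<in> nodes m L \<and> near l p q)"
    by (auto simp: near_on_def fun_eq_iff)
  obtain p q where "p \<in> nodes m L" "q \<in> nodes m L" "\<not> (near_on m l L ^^ (D - 1)) p q"
    using assms(3) by (auto simp: diam_le_def)
  then show ?thesis
    using diam_blowup[OF symp_near near_refl surj assms(1)] assms(2)
    unfolding net_simps links_def diam_le_def R by blast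
qed

section \<open>Reading the parity off a solution\<close>

lemma is_kecss_free_links:
  assumes "x \<subseteq> {..<m}" "odd (card (x \<inter> y))"
  shows "is_kecss k (net x y) (free_links x y)"
proof -
  have R: "free_step m l L x y = (\<lambda>p q. p \<in> nodes m L \<and> q \<in> nodes m L \<and>
      (near l p q \<and> free m L x y p q) \<and> (sturdy p \<or> sturdy q))"
    by (auto simp: free_step_def fun_eq_iff)
  have "k_edge_connected k {..<n} (free_links x y)"
    unfolding free_links_def
  proof (rule k_edge_connected_blowup[OF symp_free_near surj, where big = sturdy])
    show "(\<lambda>p q. p \<in> nodes m L \<and> q \<in> nodes m L \<and>
      (near l p q \<and> free m L x y p q) \<and> (sturdy p \<or> sturdy q))\<^sup>*\<^sup>* p q"
      if "p \<in> nodes m L" "q \<in> nodes m L" for p q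
      using free_step_connected[OF assms L that, of l] unfolding R .
    show "(near l p p \<and> free m L x y p p) \<and> k + 2 \<le> card {v. v < n \<and> \<phi> v = p}"
      if "p \<in> nodes m L" "sturdy p" for p
      using fibre[OF that] by (simp only: near_refl free_def simp_thms)
  qed (use spine_unique in blast)
  moreover have "free_links x y \<subseteq> links" by (auto simp: free_links_def links_def blowup_def)
  ultimately show ?thesis by (simp add: is_kecss_def)
qed

text \<open>Along edges of weight 0 the label is constant, but both labels occur on level 0.\<close>

lemma is_kecss_positive_edge:
  assumes "x \<subseteq> {..<m}" "even (card (x \<inter> y))" and H: "is_kecss k (net x y) H"
  shows "\<exists>u v. {u, v} \<in> H \<and> weight (net x y) {u, v} = 1"
proof (rule ccontr)
  assume none: "\<not> ?thesis"
  have sub: "H \<subseteq> links" using H by (simp add: is_kecss_def)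
  have same: "label x y (fst (\<phi> u)) = label x y (fst (\<phi> v))" if "(adj H)\<^sup>*\<^sup>* u v" for u v
    using that
  proof (induction rule: rtranclp_induct)
    case (step v w)
    then have "{v, w} \<in> H" by (simp add: adj_def)
    then have "near l (\<phi> v) (\<phi> w)" "free m L x y (\<phi> v) (\<phi> w)"
      using sub none in_links by (auto split: if_splits)
    then show ?case using step.IH label_free[OF assms(1,2)] by simp
  qed simp
  have "(Rail 0 b, 0) \<in> \<phi> ` {..<n}" for b using L by (simp add: surj nodes_def)
  from this[of False] this[of True] obtain u v
    where uv: "u < n" "v < n" "\<phi> u = (Rail 0 False, 0)" "\<phi> v = (Rail 0 True, 0)"
    by (auto simp: image_iff)
  have "connected_graph {..<n} (H - {})"
    using H k unfolding is_kecss_def k_edge_connected_def by (auto dest!: spec[of _ "{}"])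
  then show False using same[of u v] uv by (auto simp: connected_graph_def)
qed

text \<open>A selected edge of weight 1 is evidence of even parity that its own ends can see.
  Acceptance by all vertices is thus a conjunction of local tests, as the rectangle argument
  requires.\<close>

definition accepts :: "algorithm \<Rightarrow> network \<Rightarrow> nat \<Rightarrow> state \<Rightarrow> bool" where
  "accepts A G v s \<longleftrightarrow> (\<forall>S u. result A s = Some S \<longrightarrow> u \<in> S \<longrightarrow> incident G v u \<noteq> Some 1)"

lemma opt_cost_odd:
  assumes "x \<subseteq> {..<m}" "odd (card (x \<inter> y))"
  shows "opt_cost k (net x y) = 0"
proof -
  have "weight (net x y) e = 0" if "e \<in> free_links x y" for e
    using that by (auto simp: free_links_def blowup_def)
  then have "cost (net x y) (free_links x y) = 0" by (simp add: cost_def)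
  moreover have "finite {H. is_kecss k (net x y) H}"
    by (rule finite_subset[of _ "Pow links"]) (auto simp: is_kecss_def links_def finite_blowup)
  then have "finite {cost (net x y) H | H. is_kecss k (net x y) H}" by simp
  ultimately show ?thesis
    unfolding opt_cost_def using is_kecss_free_links[OF assms]
    by (metis (mono_tags, lifting) Min_le le_zero_eq mem_Collect_eq)
qed

lemma solved_accepts:
  assumes x: "x \<subseteq> {..<m}" and sol: "solved k \<alpha> A (net x y) cfg"
  shows "(\<forall>v<n. accepts A (net x y) v (cfg v)) \<longleftrightarrow> odd (card (x \<inter> y))"
proof -
  obtain a H where H: "is_kecss k (net x y) H" "real (cost (net x y) H) \<le> a * real (opt_cost k (net x y))"
    and res: "\<And>v. v < n \<Longrightarrow> result A (cfg v) = Some {u. {v, u} \<in> H}"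
    using sol by (auto simp: solved_def approx_kecss_def)
  have sub: "H \<subseteq> links" using H by (simp add: is_kecss_def)
  show ?thesis
  proof
    assume odd: "odd (card (x \<inter> y))"
    have "finite H" using sub by (rule finite_subset) (simp add: links_def finite_blowup)
    \<comment> \<open>The guarantee reads \<open>cost \<le> a * 0\<close>, so the ratio
      disappears.\<close>
    moreover have "cost (net x y) H = 0" using H(2) opt_cost_odd[OF x odd] by simp
    ultimately have "weight (net x y) e = 0" if "e \<in> H" for e using that by (simp add: cost_def)
    then show "\<forall>v<n. accepts A (net x y) v (cfg v)"
      using res by (auto simp: accepts_def incident_def simp del: net_simps(3))
  next
    assume acc: "\<forall>v<n. accepts A (net x y) v (cfg v)"
    show "odd (card (x \<inter> y))"
    proof (rule ccontr)
      assume "\<not> odd (card (x \<inter> y))"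
      then obtain u v where uv: "{u, v} \<in> H" "weight (net x y) {u, v} = 1"
        using is_kecss_positive_edge[OF x _ H(1)] by auto
      then have u: "u < n" "{u, v} \<in> links" using sub in_links by blast+
      then have "incident (net x y) u v \<noteq> Some 1"
        using acc res[of u] uv(1) unfolding accepts_def by blast
      then show False using u uv(2) by (simp add: incident_def del: net_simps(3))
    qed
  qed
qed

lemma incident_left:
  assumes "col v \<noteq> 0"
  shows "incident (net x y) v = incident (net x' y) v"
proof -
  have "free m L x y (\<phi> v) (\<phi> u) = free m L x' y (\<phi> v) (\<phi> u)" for u
    using assms free_left[of "\<phi> v" "\<phi> u" m L x y x'] by (cases "col u = col v") (simp_all add: free_def)
  then show ?thesis by (simp add: incident_def fun_eq_iff)
qed

lemma incident_right:
  assumes "col v \<noteq> L - 1"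
  shows "incident (net x y) v = incident (net x y') v"
proof -
  have "free m L x y (\<phi> v) (\<phi> u) = free m L x y' (\<phi> v) (\<phi> u)" for u
    using assms free_right[of "\<phi> v" L "\<phi> u" m x y y'] by (cases "col u = col v") (simp_all add: free_def)
  then show ?thesis by (simp add: incident_def fun_eq_iff)
qed

text \<open>After \<open>t\<close> rounds the states on \<open>left_part t\<close> depend on \<open>y\<close>, and those on \<open>right_part t\<close>
  depend on \<open>x\<close>, only through the messages in \<open>crossing\<close>.\<close>

definition left_part :: "nat \<Rightarrow> nat \<Rightarrow> bool" where
  "left_part t v \<longleftrightarrow> col v + t + 2 \<le> L"

definition right_part :: "nat \<Rightarrow> nat \<Rightarrow> bool" where
  "right_part t v \<longleftrightarrow> t + 1 \<le> col v"

definition crossing :: "nat \<Rightarrow> (nat \<times> nat \<times> nat) set" where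
  "crossing T = {(t, u, v). t < T \<and> {u, v} \<in> links \<and>
    ((left_part (Suc t) v \<and> \<not> left_part t u) \<or> (right_part (Suc t) v \<and> \<not> right_part t u))}"

text \<open>Both parts shrink by one column per round, so an edge between neighbouring columns never
  crosses. A crossing edge spans at least two columns, hence is a shortcut, and its round, length
  and direction determine it.\<close>

lemma card_crossing:
  assumes l: "l = 2 ^ s"
  shows "finite (crossing T)" "card (crossing T) \<le> 2 * T * s"
proof -
  define vx where "vx j = (SOME v. v < n \<and> \<phi> v = (Spine, j))" for j
  \<comment> \<open>\<open>a\<close> is the rightmost column of \<open>left_part (Suc t)\<close>,
    respectively the rightmost one outside \<open>right_part t\<close>. A shortcut from
    \<open>i\<close> that crosses satisfies \<open>i \<le> a < i + 2 ^ e\<close>, so by alignment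
    \<open>i\<close> is \<open>a\<close> rounded down to a multiple of \<open>2 ^ e\<close>.\<close>
  define g where "g = (\<lambda>(t, e, left). let a = (if left then L - t - 3 else t); i = a div 2 ^ e * 2 ^ e in
      if left then (t, vx (i + 2 ^ e), vx i) else (t, vx i, vx (i + 2 ^ e)))"
  let ?D = "{..<T} \<times> {..<s} \<times> (UNIV :: bool set)"
  have floor: "i = a div 2 ^ e * 2 ^ e" if dvd: "2 ^ e dvd i" and a: "i \<le> a" "a < i + 2 ^ e" for a i e :: nat
  proof -
    obtain d where d: "i = 2 ^ e * d" using dvd by (rule dvdE)
    have "2 ^ e * d \<le> a" "a < 2 ^ e * Suc d" using a by (simp_all add: d algebra_simps)
    then have "a div 2 ^ e = d" by (rule div_nat_eqI)
    then show ?thesis using d by (simp add: mult.commute)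
  qed
  have vx: "vx j = v" if "v < n" "\<phi> v = (Spine, j)" for v j
  proof -
    have "vx j < n \<and> \<phi> (vx j) = (Spine, j)" unfolding vx_def by (rule someI[of _ v]) (use that in simp)
    then show ?thesis using that by (intro spine_unique) auto
  qed
  have "crossing T \<subseteq> g ` ?D"
  proof
    fix z assume "z \<in> crossing T"
    then obtain t u v where z: "z = (t, u, v)" "t < T" "{u, v} \<in> links"
      and side: "(left_part (Suc t) v \<and> \<not> left_part t u) \<or> (right_part (Suc t) v \<and> \<not> right_part t u)"
      by (auto simp: crossing_def)
    have uv: "u < n" "v < n" "near l (\<phi> u) (\<phi> v)" using z(3) in_links by blast+
    from side show "z \<in> g ` ?D"
    proof
      assume a: "left_part (Suc t) v \<and> \<not> left_part t u"
      then have far: "col v + 2 \<le> col u" by (auto simp: left_part_def)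
      then have sp: "fst (\<phi> u) = Spine" "fst (\<phi> v) = Spine" "skip l (col v) (col u)"
        using uv(3) by (auto simp: near_def skip_def)
      then obtain e where e: "2 ^ e dvd col v" "col u = col v + 2 ^ e" "col u < 2 ^ s"
        by (auto simp: skip_def l)
      have "col v = (L - t - 3) div 2 ^ e * 2 ^ e"
        using a e by (intro floor) (auto simp: left_part_def)
      moreover have "vx (col v) = v" "vx (col v + 2 ^ e) = u"
        using uv sp e by (auto intro!: vx simp: prod_eq_iff)
      ultimately have "z = g (t, e, True)" by (simp add: g_def z Let_def)
      moreover have "(2::nat) ^ e < 2 ^ s" using e by linarith
      then have "e < s" by simp
      ultimately show ?thesis using z(2) by blast
    next
      assume a: "right_part (Suc t) v \<and> \<not> right_part t u"
      then have far: "col u + 2 \<le> col v" by (auto simp: right_part_def)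
      then have sp: "fst (\<phi> u) = Spine" "fst (\<phi> v) = Spine" "skip l (col u) (col v)"
        using uv(3) by (auto simp: near_def skip_def)
      then obtain e where e: "2 ^ e dvd col u" "col v = col u + 2 ^ e" "col v < 2 ^ s"
        by (auto simp: skip_def l)
      have "col u = t div 2 ^ e * 2 ^ e"
        using a e by (intro floor) (auto simp: right_part_def)
      moreover have "vx (col u) = u" "vx (col u + 2 ^ e) = v"
        using uv sp e by (auto intro!: vx simp: prod_eq_iff)
      ultimately have "z = g (t, e, False)" by (simp add: g_def z Let_def)
      moreover have "(2::nat) ^ e < 2 ^ s" using e by linarith
      then have "e < s" by simp
      ultimately show ?thesis using z(2) by blast
    qed
  qed
  moreover have "card (g ` ?D) \<le> 2 * T * s"
    using card_image_le[of ?D g] by (simp add: card_cartesian_product mult_ac)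
  moreover have "finite (g ` ?D)" by simp
  ultimately show "finite (crossing T)" "card (crossing T) \<le> 2 * T * s"
    using finite_subset card_mono order_trans by metis+
qed

lemma card_messages: "finite {xs :: bool list. length xs \<le> B}" "card {xs :: bool list. length xs \<le> B} \<le> 2 ^ (B + 1)"
proof -
  show "finite {xs :: bool list. length xs \<le> B}"
    using finite_lists_length_le[of "UNIV :: bool set" B] by simp
  have "card {xs :: bool list. length xs \<le> B} = (\<Sum>i\<le>B. 2 ^ i)"
    using card_lists_length_le[of "UNIV :: bool set" B] by simp
  also have "\<dots> \<le> 2 ^ (B + 1)" by (induction B) auto
  finally show "card {xs :: bool list. length xs \<le> B} \<le> 2 ^ (B + 1)" .
qed

text \<open>Cut and paste: if \<open>(x, y)\<close> and \<open>(x', y')\<close> have equal crossing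
  messages, the run on \<open>(x, y')\<close> looks like the first at the left and like the second
  at the right.\<close>

lemma few_rounds_imp_few_inputs:
  assumes l: "l = 2 ^ s" and n: "n \<ge> 8" and \<gamma>: "\<gamma> \<ge> 1" and T: "2 * T + 2 \<le> L"
    and bw: "\<And>x y. respects_bandwidth b A (net x y)"
    and B: "real b * log 2 (real n) < real B + 1"
    and solved: "\<And>x y. x \<subseteq> {..<m} \<Longrightarrow> y \<subseteq> {..<m} \<Longrightarrow> solved_whp_by \<gamma> k \<alpha> A (net x y) T"
  shows "m \<le> 2 * ((B + 1) * (2 * T * s)) + 4"
proof -
  define I where "I = Pow {..<m} \<times> Pow {..<m}"
  define G where "G \<iota> = net (fst \<iota>) (snd \<iota>)" for \<iota>
  have fI: "finite I" by (simp add: I_def)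
  have verts: "verts (G \<iota>) = {..<n}" and links: "edges (G \<iota>) = links" for \<iota> by (simp_all add: G_def)
  let ?S = "\<lambda>\<iota>. {cfg. solved k \<alpha> A (G \<iota>) cfg}"
  obtain c where
    supp: "\<And>\<iota> t. \<iota> \<in> I \<Longrightarrow> t \<le> T \<Longrightarrow> c \<iota> t \<in> set_pmf (run A (G \<iota>) t)"
    and start: "\<And>\<iota> \<iota>' v. \<iota> \<in> I \<Longrightarrow> \<iota>' \<in> I \<Longrightarrow> v < n \<Longrightarrow>
      incident (G \<iota>) v = incident (G \<iota>') v \<Longrightarrow> c \<iota> 0 v = c \<iota>' 0 v"
    and next_state: "\<And>\<iota> \<iota>' v t. \<iota> \<in> I \<Longrightarrow> \<iota>' \<in> I \<Longrightarrow> v < n \<Longrightarrow> t < T \<Longrightarrow> c \<iota> t v = c \<iota>' t v \<Longrightarrow>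
      inbox A (G \<iota>) (c \<iota> t) v = inbox A (G \<iota>') (c \<iota>' t) v \<Longrightarrow> c \<iota> (Suc t) v = c \<iota>' (Suc t) v"
    and good: "(\<Sum>\<iota>\<in>I. measure_pmf.prob (run A (G \<iota>) T) (?S \<iota>)) \<le> real (card {\<iota> \<in> I. c \<iota> T \<in> ?S \<iota>})"
  proof -
    from derandomize[where G = G and T = T and A = A and S = ?S, OF fI finite_lessThan verts] that show thesis
      by (elim exE conjE) (simp only: lessThan_iff Ball_def, blast)
  qed
  define \<tau> where "\<tau> \<iota> = restrict (\<lambda>(t, u, v). send A (c \<iota> t u) v) (crossing T)" for \<iota>
  define acc where "acc \<iota> \<longleftrightarrow> (\<forall>v<n. accepts A (G \<iota>) v (c \<iota> T v))" for \<iota>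
  have paste: "(\<forall>v<n. left_part t v \<longrightarrow> c (x, y') t v = c (x, y) t v) \<and>
      (\<forall>v<n. right_part t v \<longrightarrow> c (x, y') t v = c (x', y') t v)"
    if in_I: "(x, y) \<in> I" "(x', y') \<in> I" and eq: "\<tau> (x, y) = \<tau> (x', y')" and "t \<le> T" for x y x' y' t
    using \<open>t \<le> T\<close>
  proof (induction t)
    case 0
    \<comment> \<open>At time 0 the left part omits exactly column \<open>L - 1\<close>, which sees
      \<open>y\<close>, and the right part exactly column 0, which sees \<open>x\<close>.\<close>
    have "(x, y') \<in> I" using in_I by (auto simp: I_def)
    then show ?case
      using in_I by (auto intro!: start incident_left incident_right simp: G_def left_part_def right_part_def)
  next
    case (Suc t)
    have xy': "(x, y') \<in> I" using in_I by (auto simp: I_def)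
    have t: "t < T" using Suc.prems by simp
    have IHl: "c (x, y') t u = c (x, y) t u" if "u < n" "left_part t u" for u
      using Suc t that by auto
    have IHr: "c (x, y') t u = c (x', y') t u" if "u < n" "right_part t u" for u
      using Suc t that by auto
    \<comment> \<open>This is where \<open>2 * T + 2 \<le> L\<close> is used: the two parts overlap
      until the end.\<close>
    have cover: "left_part t u \<or> right_part t u" for u
      using T t by (auto simp: left_part_def right_part_def)
    have msg: "send A (c (x, y) t u) v = send A (c (x', y') t u) v" if "(t, u, v) \<in> crossing T" for u v
      using fun_cong[OF eq, of "(t, u, v)"] that by (simp add: \<tau>_def)
    have sent_left: "send A (c (x, y') t u) v = send A (c (x, y) t u) v"
      if v: "left_part (Suc t) v" and e: "{u, v} \<in> links" for u v
    proof (cases "left_part t u")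
      case True
      then show ?thesis using IHl in_links e by auto
    next
      case False
      \<comment> \<open>The sender lies in the right part, where the mixed run agrees with
        \<open>(x', y')\<close>; equality of the transcripts then transfers the message to
        \<open>(x, y)\<close>.\<close>
      then have "(t, u, v) \<in> crossing T" using v e t by (auto simp: crossing_def)
      then show ?thesis using msg IHr cover[of u] False in_links e by auto
    qed
    have sent_right: "send A (c (x, y') t u) v = send A (c (x', y') t u) v"
      if v: "right_part (Suc t) v" and e: "{u, v} \<in> links" for u v
    proof (cases "right_part t u")
      case True
      then show ?thesis using IHr in_links e by auto
    next
      case False
      then have "(t, u, v) \<in> crossing T" using v e t by (auto simp: crossing_def)
      then show ?thesis using msg IHl cover[of u] False in_links e by auto
    qed
    show ?case
    proof (intro conjI allI impI)
      fix v assume v: "v < n" "left_part (Suc t) v"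
      show "c (x, y') (Suc t) v = c (x, y) (Suc t) v"
      proof (rule next_state[OF xy' in_I(1) v(1) t])
        show "c (x, y') t v = c (x, y) t v" using v by (intro IHl) (auto simp: left_part_def)
        show "inbox A (G (x, y')) (c (x, y') t) v = inbox A (G (x, y)) (c (x, y) t) v"
          using sent_left[OF v(2)] by (auto simp: inbox_def links fun_eq_iff insert_commute)
      qed
    next
      fix v assume v: "v < n" "right_part (Suc t) v"
      show "c (x, y') (Suc t) v = c (x', y') (Suc t) v"
      proof (rule next_state[OF xy' in_I(2) v(1) t])
        show "c (x, y') t v = c (x', y') t v" using v by (intro IHr) (auto simp: right_part_def)
        show "inbox A (G (x, y')) (c (x, y') t) v = inbox A (G (x', y')) (c (x', y') t) v"
          using sent_right[OF v(2)] by (auto simp: inbox_def links fun_eq_iff insert_commute)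
      qed
    qed
  qed
  show ?thesis
  proof (rule rectangles_compute_inner_product[of m \<tau> acc])
    fix x y x' y'
    assume "(x, y) \<in> Pow {..<m} \<times> Pow {..<m}" "(x', y') \<in> Pow {..<m} \<times> Pow {..<m}"
    then have in_I: "(x, y) \<in> I" "(x', y') \<in> I" by (simp_all add: I_def)
    assume eq: "\<tau> (x, y) = \<tau> (x', y')" and acc: "acc (x, y)" "acc (x', y')"
    have cover: "left_part t u \<or> right_part t u" if "t \<le> T" for t u
      using T that by (auto simp: left_part_def right_part_def)
    have "\<tau> (x, y') z = \<tau> (x, y) z" for z
    proof (cases "z \<in> crossing T")
      case True
      then obtain t u v where z: "z = (t, u, v)" "t < T" "{u, v} \<in> links"
        by (auto simp: crossing_def)
      then have u: "u < n" using in_links by blast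
      have "c (x, y') t u = c (x, y) t u \<or> c (x, y') t u = c (x', y') t u"
        using cover[of t u] paste[OF in_I eq, of t] u z(2) by auto
      then have "\<tau> (x, y') z = \<tau> (x, y) z \<or> \<tau> (x, y') z = \<tau> (x', y') z"
        using True by (auto simp: \<tau>_def z(1))
      then show ?thesis using eq by auto
    qed (simp add: \<tau>_def)
    moreover have "accepts A (G (x, y')) v (c (x, y') T v)" if v: "v < n" for v
      using cover[of T v]
    proof
      assume "left_part T v"
      then have "c (x, y') T v = c (x, y) T v" "incident (G (x, y')) v = incident (G (x, y)) v"
        using paste[OF in_I eq, of T] v by (auto simp: G_def left_part_def intro!: incident_right)
      then show ?thesis using acc(1) v by (simp add: acc_def accepts_def)
    next
      assume "right_part T v"
      then have "c (x, y') T v = c (x', y') T v" "incident (G (x, y')) v = incident (G (x', y')) v"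
        using paste[OF in_I eq, of T] v by (auto simp: G_def right_part_def intro!: incident_left)
      then show ?thesis using acc(2) v by (simp add: acc_def accepts_def)
    qed simp
    ultimately show "\<tau> (x, y') = \<tau> (x, y) \<and> acc (x, y')" by (auto simp: acc_def)
  next
    let ?M = "{xs :: bool list. length xs \<le> B}"
    note cr = card_crossing[OF l, of T]
    have "length (send A (c \<iota> t u) v) \<le> B" if "\<iota> \<in> I" "(t, u, v) \<in> crossing T" for \<iota> t u v
    proof -
      have "t < T" "{u, v} \<in> links" using that by (auto simp: crossing_def)
      then have "real (length (send A (c \<iota> t u) v)) \<le> real b * log 2 (real n)"
        using supp[OF that(1), of t] bw[of "fst \<iota>" "snd \<iota>"]
        unfolding respects_bandwidth_def G_def net_simps by auto
      then show ?thesis using B by linarith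
    qed
    then have "\<tau> ` I \<subseteq> (\<Pi>\<^sub>E z\<in>crossing T. ?M)" by (auto simp: \<tau>_def)
    moreover have "finite (\<Pi>\<^sub>E z\<in>crossing T. ?M)" using cr card_messages by (intro finite_PiE) auto
    ultimately have "card (\<tau> ` I) \<le> card (\<Pi>\<^sub>E z\<in>crossing T. ?M)" by (rule card_mono[rotated])
    also have "\<dots> = card ?M ^ card (crossing T)" using cr by (simp add: card_PiE)
    also have "\<dots> \<le> (2 ^ (B + 1)) ^ card (crossing T)" by (intro power_mono card_messages) simp
    also have "\<dots> \<le> (2 ^ (B + 1)) ^ (2 * T * s)" by (intro power_increasing cr) simp
    also have "\<dots> = 2 ^ ((B + 1) * (2 * T * s))" by (rule power_mult[symmetric])
    finally show "real (card (\<tau> ` (Pow {..<m} \<times> Pow {..<m}))) \<le> 2 ^ ((B + 1) * (2 * T * s))"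
      unfolding I_def by (metis of_nat_le_iff of_nat_numeral of_nat_power)
  next
    \<comment> \<open>The failure probability is at most \<open>1 / n \<le> 1 / 8\<close>.\<close>
    have "7 / 8 \<le> 1 - 1 / real n powr \<gamma>"
    proof -
      have "real n powr 1 \<le> real n powr \<gamma>" using n \<gamma> by (intro powr_mono) auto
      then have "8 \<le> real n powr \<gamma>" using n by simp
      then have "1 / real n powr \<gamma> \<le> 1 / 8" using n by (intro divide_left_mono) auto
      then show ?thesis by simp
    qed
    then have "7 / 8 \<le> measure_pmf.prob (run A (G \<iota>) T) (?S \<iota>)" if "\<iota> \<in> I" for \<iota>
      using solved[of "fst \<iota>" "snd \<iota>"] that unfolding solved_whp_by_def I_def G_def by force
    then have "(\<Sum>\<iota>\<in>I. 7 / 8) \<le> (\<Sum>\<iota>\<in>I. measure_pmf.prob (run A (G \<iota>) T) (?S \<iota>))"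
      by (rule sum_mono)
    also note good
    also have "card {\<iota> \<in> I. c \<iota> T \<in> ?S \<iota>} \<le> card {\<iota> \<in> I. acc \<iota> \<longleftrightarrow> odd (card (fst \<iota> \<inter> snd \<iota>))}"
    proof (rule card_mono)
      show "{\<iota> \<in> I. c \<iota> T \<in> ?S \<iota>} \<subseteq> {\<iota> \<in> I. acc \<iota> \<longleftrightarrow> odd (card (fst \<iota> \<inter> snd \<iota>))}"
      proof
        fix \<iota> assume "\<iota> \<in> {\<iota> \<in> I. c \<iota> T \<in> ?S \<iota>}"
        then have "\<iota> \<in> I" "fst \<iota> \<subseteq> {..<m}" "solved k \<alpha> A (net (fst \<iota>) (snd \<iota>)) (c \<iota> T)"
          by (auto simp: I_def G_def)
        then show "\<iota> \<in> {\<iota> \<in> I. acc \<iota> \<longleftrightarrow> odd (card (fst \<iota> \<inter> snd \<iota>))}"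
          using solved_accepts[of "fst \<iota>" \<alpha> A "snd \<iota>" "c \<iota> T"] by (simp add: acc_def G_def)
      qed
    qed (use fI in simp)
    finally have "real (card I) * (7 / 8) \<le> real (card {\<iota> \<in> I. acc \<iota> \<longleftrightarrow> odd (card (fst \<iota> \<inter> snd \<iota>))})"
      by simp
    moreover have "card I = 4 ^ m"
      by (simp add: I_def card_cartesian_product card_Pow flip: power_mult_distrib)
    then have "real (card I) = 4 ^ m" by simp
    ultimately have "7 / 8 * 4 ^ m \<le> real (card {\<iota> \<in> I. acc \<iota> \<longleftrightarrow> odd (card (fst \<iota> \<inter> snd \<iota>))})" by linarith
    then show "7 / 8 * 4 ^ m \<le>
        real (card {\<iota> \<in> Pow {..<m} \<times> Pow {..<m}. acc \<iota> \<longleftrightarrow> odd (card (fst \<iota> \<inter> snd \<iota>))})"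
      unfolding I_def .
  qed
qed

end

text \<open>The paths have length at least \<open>2 ^ s\<close> and at least \<open>D\<close>, so
  either alternative for \<open>T\<close> makes them long enough. The 5 is one more than the 4 in
  the bound on \<open>m\<close>; the last premise pays for up to \<open>2 ^ s + D\<close>
  columns.\<close>

lemma hard_instance:
  assumes alg: "approx_algorithm b i w \<gamma> k \<alpha> A" and "i \<ge> 1" "w \<ge> 1" "\<gamma> \<ge> 1" "k \<ge> 1" "n \<ge> 8"
    and B: "real b * log 2 (real n) < real B + 1"
    and m: "2 * ((B + 1) * (2 * T * s)) + 5 \<le> m"
    and D: "2 * s + 2 \<le> D" and T: "2 * T + 2 \<le> 2 ^ s \<or> 2 * T + 2 \<le> D"
    and n: "(2 ^ s + D) * ((4 * m + 2) * (k + 2) + 1) \<le> n"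
  shows "\<exists>G. kecss_input i w k n G \<and> hop_diameter G = D \<and> T < rounds \<gamma> k \<alpha> A G"
proof -
  obtain len where len: "2 ^ s \<le> len" "len \<le> 2 ^ s + D" "D \<le> len" "diam_le m (2 ^ s) len D"
    "\<not> diam_le m (2 ^ s) len (D - 1)"
    using obtain_length[OF D] .
  have len1: "len \<ge> 1" using len D by linarith
  have "len * ((4 * m + 2) * (k + 2) + 1) \<le> n" using len n by (meson mult_le_mono1 order_trans)
  then obtain \<phi> where "assignment n k m len \<phi>" using ex_assignment len1 by blast
  then interpret hard_network n k m "2 ^ s" len \<phi> using \<open>k \<ge> 1\<close> len1 by unfold_locales
  have input: "kecss_input i w k n (net x y)" for x y using net_input assms by blast
  have diam: "hop_diameter (net x y) = D" for x y using len D by (intro hop_diameter_net) auto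
  have n1: "n \<ge> 1" using \<open>n \<ge> 8\<close> by simp
  have irr: "irrevocable A" and bw: "respects_bandwidth b A (net x y)"
    and ex: "\<exists>t. solved_whp_by \<gamma> k \<alpha> A (net x y) t" for x y
    using alg input[of x y] n1 unfolding approx_algorithm_def by blast+
  have "\<exists>x y. T < rounds \<gamma> k \<alpha> A (net x y)"
  proof (rule ccontr)
    assume "\<not> ?thesis"
    then have fast: "rounds \<gamma> k \<alpha> A (net x y) \<le> T" for x y by (simp add: not_less)
    have "solved_whp_by \<gamma> k \<alpha> A (net x y) T" for x y
    proof (rule solved_whp_by_mono[OF irr _ _ fast])
      show "solved_whp_by \<gamma> k \<alpha> A (net x y) (rounds \<gamma> k \<alpha> A (net x y))"
        unfolding rounds_def using ex by (rule LeastI_ex)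
    qed simp
    then have "m \<le> 2 * ((B + 1) * (2 * T * s)) + 4"
      using assms len by (intro few_rounds_imp_few_inputs[OF refl _ _ _ bw]) auto
    then show False using m by simp
  qed
  then show ?thesis using input diam by blast
qed

section \<open>Choice of the parameters\<close>

text \<open>With \<open>s = 0\<close> there are no shortcuts and no crossing messages, so
  \<open>m = 5\<close> suffices.\<close>

lemma rounds_ge_diameter:
  assumes alg: "approx_algorithm b i w \<gamma> k \<alpha> A" and "i \<ge> 1" "w \<ge> 1" "\<gamma> \<ge> 1" "k \<ge> 1"
    and D: "D \<ge> 2" and n: "134 * (D * k) \<le> n"
  shows "\<exists>G. kecss_input i w k n G \<and> hop_diameter G = D \<and> real D \<le> 3 * real (rounds \<gamma> k \<alpha> A G)"
proof -
  define T where "T = (D - 2) div 2"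
  have "1 * 1 \<le> D * k" using D \<open>k \<ge> 1\<close> by (intro mult_le_mono) auto
  then have n8: "n \<ge> 8" using n by linarith
  \<comment> \<open>The 134 is \<open>2 * 67\<close>, from \<open>1 + D \<le> 2 * D\<close> and
    \<open>22 * (k + 2) + 1 \<le> 67 * k\<close>.\<close>
  have "(2 ^ 0 + D) * ((4 * 5 + 2) * (k + 2) + 1) \<le> (2 * D) * (67 * k)"
    using D \<open>k \<ge> 1\<close> by (intro mult_le_mono) auto
  also have "\<dots> = 134 * (D * k)" by simp
  finally have "(2 ^ 0 + D) * ((4 * 5 + 2) * (k + 2) + 1) \<le> n" using n by linarith
  moreover obtain B :: nat where "real b * log 2 (real n) < real B + 1"
    by (meson reals_Archimedean2 less_add_one less_trans)
  moreover have "2 * T + 2 \<le> D" using D by (simp add: T_def)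
  ultimately obtain G where G: "kecss_input i w k n G" "hop_diameter G = D" "T < rounds \<gamma> k \<alpha> A G"
    using hard_instance[of b i w \<gamma> k \<alpha> A n B T 0 5 D] assms n8 by auto
  then have "D \<le> 3 * rounds \<gamma> k \<alpha> A G" using D by (simp add: T_def)
  then show ?thesis using G by (intro exI[of _ G]) (simp flip: of_nat_le_iff[where 'a = real])
qed

lemma obtain_power_between:
  fixes x :: nat
  assumes "x \<ge> 1"
  obtains s where "x \<le> 2 ^ s" "2 ^ s \<le> 2 * x"
proof -
  define s where "s = (LEAST s. x \<le> 2 ^ s)"
  have "x \<le> 2 ^ x" by (rule less_imp_le[OF less_exp])
  then have le: "x \<le> 2 ^ s" unfolding s_def by (rule LeastI)
  have "2 ^ s \<le> 2 * x"
  proof (cases s)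
    case 0
    then show ?thesis using assms by simp
  next
    case (Suc r)
    then have "\<not> x \<le> 2 ^ r" using not_less_Least[of r "\<lambda>s. x \<le> 2 ^ s"] by (simp add: s_def)
    then show ?thesis using Suc by simp
  qed
  then show ?thesis using that le by blast
qed

text \<open>The constants split the budget \<open>n = q^2 * lg^2 * k\<close> in halves. With at most
  \<open>9 * q\<close> columns and \<open>k + 2 \<le> 3 * k\<close>, the main part of
  \<open>m\<close> costs \<open>9 * 32 * 3 / 1728 = 1 / 2\<close> of it; the additive 23 costs
  \<open>9 * 23 * 3 = 621\<close> times \<open>q * k\<close>, at most the other half because
  \<open>q * lg^2\<close> is at least \<open>1242 = 2 * 621\<close>.\<close>

lemma rounds_ge_sqrt:
  fixes n k D :: nat
  defines "q \<equiv> sqrt (real n / real k) / log 2 (real n)"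
  assumes alg: "approx_algorithm b i w \<gamma> k \<alpha> A" and "i \<ge> 1" "w \<ge> 1" "\<gamma> \<ge> 1" "k \<ge> 1" and n8: "n \<ge> 8"
    and D: "1242 * log 2 (real n) \<le> real D" "real D \<le> q"
  shows "\<exists>G. kecss_input i w k n G \<and> hop_diameter G = D \<and>
    q / (1728 * (real b + 1)) \<le> real (rounds \<gamma> k \<alpha> A G)"
proof -
  define lg where "lg = log 2 (real n)"
  define c where "c = 1 / (1728 * (real b + 1))"
  define T where "T = nat \<lfloor>c * q\<rfloor>"
  define B where "B = nat \<lfloor>real b * lg\<rfloor>"
  have lg: "lg \<ge> 3" using n8 by (simp add: lg_def le_log_iff)
  have D1: "real D \<ge> 1242 * lg" "real D \<le> q" using D by (simp_all add: lg_def)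
  then have q: "q \<ge> 1242 * lg" "q \<ge> 1242" using lg by linarith+
  have c: "0 < c" "c \<le> 1" by (simp_all add: c_def field_simps)
  have qlg: "q * lg = sqrt (real n / real k)" using lg by (simp add: q_def lg_def)
  have nk: "q\<^sup>2 * lg\<^sup>2 * real k = real n"
    using \<open>k \<ge> 1\<close> by (simp add: qlg flip: power_mult_distrib)
  have T: "real T \<le> c * q" "c * q < real T + 1" using c q unfolding T_def by (auto simp: mult_nonneg_nonneg)
  have cq: "c * q \<le> q" using c q by (simp add: mult_left_le_one_le)
  have q_le_n: "q \<le> real n"
  proof -
    have "sqrt (real n / real k) \<le> sqrt (real n)" using \<open>k \<ge> 1\<close> divide_left_mono[of 1 "real k" "real n"] by simp
    also have "\<dots> \<le> real n" using n8 by (simp add: sqrt_le_D real_sqrt_le_iff real_le_lsqrt power2_eq_square)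
    finally have "sqrt (real n / real k) \<le> real n" .
    moreover have "q * 1 \<le> q * lg" using q lg by (intro mult_left_mono) auto
    ultimately show ?thesis using qlg by linarith
  qed
  obtain s where s: "2 * T + 2 \<le> 2 ^ s" "2 ^ s \<le> 2 * (2 * T + 2)"
    using obtain_power_between[of "2 * T + 2"] by auto
  have s_lg: "real s \<le> 2 * lg"
  proof -
    have "real (2 ^ s) \<le> real (2 * (2 * T + 2))" using s(2) by (rule of_nat_mono)
    also have "\<dots> \<le> 8 * real n" using T(1) cq q_le_n n8 by simp
    also have "\<dots> \<le> real n * real n" using n8 by (intro mult_right_mono) auto
    finally have "2 ^ s \<le> (real n) ^ 2" by (simp add: power2_eq_square)
    then have "log 2 (2 ^ s) \<le> log 2 ((real n)^2)" using n8 by (subst log_le_cancel_iff) auto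
    then show ?thesis using n8 by (simp add: log_nat_power lg_def)
  qed
  define m where "m = 2 * ((B + 1) * (2 * T * s)) + 5"
  have B: "real b * lg < real B + 1" "real B \<le> real b * lg"
    using lg unfolding B_def by (auto simp: mult_nonneg_nonneg)
  have B1: "real B + 1 \<le> (real b + 1) * lg" using B lg by (simp add: algebra_simps)
  have "real (T * s) \<le> (c * q) * (2 * lg)"
    unfolding of_nat_mult using T s_lg c q by (intro mult_mono) auto
  then have "(real B + 1) * real (T * s) \<le> ((real b + 1) * lg) * ((c * q) * (2 * lg))"
    using B1 lg by (intro mult_mono) auto
  also have "\<dots> = 2 * q * lg\<^sup>2 / 1728" by (simp add: c_def power2_eq_square field_simps)
  finally have m: "real (4 * m + 3) \<le> 32 * q * lg\<^sup>2 / 1728 + 23"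
    by (simp add: m_def algebra_simps)
  have len: "real (2 ^ s + D) \<le> 9 * q"
  proof -
    have "real (2 ^ s) \<le> real (2 * (2 * T + 2))" using s(2) by (rule of_nat_mono)
    moreover have "real T \<le> q" using T(1) cq by linarith
    ultimately show ?thesis using D1 q by simp
  qed
  have "(4 * m + 2) * (k + 2) + 1 \<le> (4 * m + 3) * (3 * k)"
  proof -
    have "(4 * m + 2) * (k + 2) + 1 \<le> (4 * m + 3) * (k + 2)" by (simp add: algebra_simps)
    also have "\<dots> \<le> (4 * m + 3) * (3 * k)" using \<open>k \<ge> 1\<close> by (intro mult_le_mono2) simp
    finally show ?thesis .
  qed
  then have "(2 ^ s + D) * ((4 * m + 2) * (k + 2) + 1) \<le> (2 ^ s + D) * ((4 * m + 3) * (3 * k))"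
    by (rule mult_le_mono2)
  then have "real ((2 ^ s + D) * ((4 * m + 2) * (k + 2) + 1))
      \<le> real (2 ^ s + D) * (real (4 * m + 3) * (3 * real k))"
    by (metis of_nat_le_iff of_nat_mult of_nat_numeral)
  also have "\<dots> \<le> (9 * q) * ((32 * q * lg\<^sup>2 / 1728 + 23) * (3 * real k))"
    using q by (intro mult_mono len mult_right_mono m) auto
  also have "\<dots> = (q\<^sup>2 * lg\<^sup>2 * real k) / 2 + 621 * (q * real k)"
    by (simp add: power2_eq_square field_simps)
  also have "\<dots> \<le> (q\<^sup>2 * lg\<^sup>2 * real k) / 2 + (q\<^sup>2 * lg\<^sup>2 * real k) / 2"
  proof -
    have "1242 * 1 \<le> q * lg\<^sup>2" using q lg by (intro mult_mono) auto
    then have "1242 * (q * real k) \<le> (q * lg\<^sup>2) * (q * real k)" using q by (intro mult_right_mono) auto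
    then show ?thesis by (simp add: power2_eq_square mult_ac)
  qed
  also have "\<dots> = real n" using nk by simp
  finally have size: "(2 ^ s + D) * ((4 * m + 2) * (k + 2) + 1) \<le> n" by (simp only: of_nat_le_iff)
  have "real (2 * s + 2) \<le> real D" using s_lg D1 lg by simp
  then have "2 * s + 2 \<le> D" by (simp only: of_nat_le_iff)
  then obtain G where G: "kecss_input i w k n G" "hop_diameter G = D" "T < rounds \<gamma> k \<alpha> A G"
    using hard_instance[of b i w \<gamma> k \<alpha> A n B T s m D] assms(2-6) n8 B(1) s(1) size
    by (auto simp: lg_def m_def)
  have "c * q \<le> real (rounds \<gamma> k \<alpha> A G)" using T(2) G(3) by linarith
  then show ?thesis using G by (intro exI[of _ G]) (simp add: c_def)
qed

text \<open>The larger of the two terms is at least half of their sum, hence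
  \<open>3456 = 2 * 1728\<close>.\<close>

lemma rounds_ge_lower_bound:
  assumes alg: "approx_algorithm b i w \<gamma> k \<alpha> A" and "i \<ge> 1" "w \<ge> 1" "\<gamma> \<ge> 1" "k \<ge> 1" and n8: "n \<ge> 8"
    and D: "1242 * log 2 (real n) \<le> real D" "real D \<le> real n / (1242 * real k)"
  shows "\<exists>G. kecss_input i w k n G \<and> hop_diameter G = D \<and>
    lower_bound k n D / (3456 * (real b + 1)) \<le> real (rounds \<gamma> k \<alpha> A G)"
proof (cases "real D \<le> sqrt (real n / real k) / log 2 (real n)")
  case True
  then obtain G where G: "kecss_input i w k n G" "hop_diameter G = D"
    "sqrt (real n / real k) / log 2 (real n) / (1728 * (real b + 1)) \<le> real (rounds \<gamma> k \<alpha> A G)"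
    using rounds_ge_sqrt[OF alg] assms by blast
  have "lower_bound k n D / (3456 * (real b + 1))
      \<le> 2 * (sqrt (real n / real k) / log 2 (real n)) / (3456 * (real b + 1))"
    using True by (intro divide_right_mono) (auto simp: lower_bound_def)
  also have "\<dots> = sqrt (real n / real k) / log 2 (real n) / (1728 * (real b + 1))"
  proof -
    have "2 * u / (3456 * v) = u / (1728 * v)" for u v :: real by simp
    then show ?thesis .
  qed
  finally show ?thesis using G by (intro exI[of _ G]) simp
next
  case False
  have "3 \<le> log 2 (real n)" using n8 by (simp add: le_log_iff)
  then have "D \<ge> 2" using D(1) by simp
  moreover have "1242 * (real D * real k) \<le> real n" using D(2) \<open>k \<ge> 1\<close> by (simp add: field_simps)
  then have "real (134 * (D * k)) \<le> real n" by simp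
  then have "134 * (D * k) \<le> n" by (simp only: of_nat_le_iff)
  ultimately obtain G where G: "kecss_input i w k n G" "hop_diameter G = D"
    "real D \<le> 3 * real (rounds \<gamma> k \<alpha> A G)"
    using rounds_ge_diameter[OF alg] assms by blast
  have "lower_bound k n D / (3456 * (real b + 1)) \<le> (2 * real D) / (3456 * (real b + 1))"
    using False by (intro divide_right_mono) (auto simp: lower_bound_def)
  also have "\<dots> \<le> (2 * real D) / 6" by (intro divide_left_mono) auto
  also have "\<dots> \<le> real (rounds \<gamma> k \<alpha> A G)" using G(3) by simp
  finally show ?thesis using G by blast
qed

text \<open>The upper end of the range of \<open>D\<close> is natural: minimum degree
  \<open>k\<close> in a simple graph already forces diameter \<open>O(n / k)\<close>.\<close>

theorem theoremA6:
  fixes b i w :: nat and \<gamma> :: real and \<alpha> :: "nat \<Rightarrow> real"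
  assumes "i \<ge> 1" and "w \<ge> 1" and "\<gamma> \<ge> 1"
    and "\<And>n. \<alpha> n \<ge> 1" and "polynomially_bounded \<alpha>"
  shows "\<exists>c > 0. \<exists>C > 0. \<forall>k \<ge> 1. \<forall>A. approx_algorithm b i w \<gamma> k \<alpha> A \<longrightarrow>
    (\<forall>n::nat. real n \<ge> C * real k \<longrightarrow>
      (\<forall>D::nat. C * log 2 (real n) \<le> real D \<and> real D \<le> real n / (C * real k) \<longrightarrow>
        (\<exists>G. kecss_input i w k n G \<and> hop_diameter G = D \<and>
             real (rounds \<gamma> k \<alpha> A G) \<ge> c * lower_bound k n D)) \<and>
      (\<exists>G. kecss_input i w k n G \<and> real (hop_diameter G) \<le> C * log 2 (real n) \<and>
           real (rounds \<gamma> k \<alpha> A G) \<ge> c * lower_bound k n (hop_diameter G)))"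
proof -
  \<comment> \<open>The threshold of \<open>rounds_ge_lower_bound\<close>. The final constant is
    twice as large, to leave room for rounding \<open>C1 * log n\<close> up to an integer.\<close>
  define C1 :: real where "C1 = 1242"
  define K where "K = C1\<^sup>2 + C1"
  define c where "c = min (1 / (3456 * (real b + 1))) (1 / (3 * (2 + K)))"
  have c: "c > 0" "c \<le> 1 / (3456 * (real b + 1))" "c \<le> 1 / (3 * (2 + K))"
    by (auto simp: c_def K_def C1_def)
  have main: "(\<forall>D::nat. (2 * C1) * log 2 (real n) \<le> real D \<and> real D \<le> real n / ((2 * C1) * real k) \<longrightarrow>
        (\<exists>G. kecss_input i w k n G \<and> hop_diameter G = D \<and>
             real (rounds \<gamma> k \<alpha> A G) \<ge> c * lower_bound k n D)) \<and>
      (\<exists>G. kecss_input i w k n G \<and> real (hop_diameter G) \<le> (2 * C1) * log 2 (real n) \<and>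
           real (rounds \<gamma> k \<alpha> A G) \<ge> c * lower_bound k n (hop_diameter G))"
    if k: "k \<ge> 1" and alg: "approx_algorithm b i w \<gamma> k \<alpha> A" and n: "real n \<ge> (2 * C1) * real k" for k A n
  proof -
    have "2 * C1 * 1 \<le> 2 * C1 * real k" using k by (intro mult_left_mono) (auto simp: C1_def)
    then have "real n \<ge> 8" using n by (simp add: C1_def)
    then have n8: "n \<ge> 8" by simp
    then have lg: "log 2 (real n) \<ge> 3" by (simp add: le_log_iff)
    have diameter: "\<exists>G. kecss_input i w k n G \<and> hop_diameter G = D \<and>
        c * lower_bound k n D \<le> real (rounds \<gamma> k \<alpha> A G)"
      if D: "C1 * log 2 (real n) \<le> real D" "real D \<le> real n / (C1 * real k)" for D
    proof -
      have "0 \<le> lower_bound k n D" using lg by (simp add: lower_bound_def)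
      then have "c * lower_bound k n D \<le> 1 / (3456 * (real b + 1)) * lower_bound k n D"
        using c by (intro mult_right_mono) auto
      then show ?thesis
        using rounds_ge_lower_bound[OF alg assms(1-3) k n8, of D] D by (force simp: C1_def)
    qed
    show ?thesis
    proof (intro conjI allI impI)
      fix D :: nat
      assume "(2 * C1) * log 2 (real n) \<le> real D \<and> real D \<le> real n / ((2 * C1) * real k)"
      moreover have "real n / ((2 * C1) * real k) \<le> real n / (C1 * real k)"
        using k by (intro divide_left_mono) (auto simp: C1_def)
      ultimately show "\<exists>G. kecss_input i w k n G \<and> hop_diameter G = D \<and>
          c * lower_bound k n D \<le> real (rounds \<gamma> k \<alpha> A G)"
        using lg by (intro diameter) (auto simp: C1_def)
    next
      show "\<exists>G. kecss_input i w k n G \<and> real (hop_diameter G) \<le> (2 * C1) * log 2 (real n) \<and>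
           real (rounds \<gamma> k \<alpha> A G) \<ge> c * lower_bound k n (hop_diameter G)"
      proof (cases "C1 * log 2 (real n) + 1 \<le> real n / (C1 * real k)")
        case True
        define D where "D = nat \<lceil>C1 * log 2 (real n)\<rceil>"
        have "0 \<le> C1 * log 2 (real n)" using lg by (simp add: C1_def)
        then have D: "C1 * log 2 (real n) \<le> real D" "real D \<le> C1 * log 2 (real n) + 1"
          unfolding D_def by linarith+
        moreover have "real D \<le> (2 * C1) * log 2 (real n)" using D(2) lg by (simp add: C1_def)
        ultimately show ?thesis using diameter[of D] True by force
      next
        case False
        \<comment> \<open>Here \<open>n / k\<close> is only logarithmic, so the square root term is
          at most the constant \<open>K\<close>, and a network of diameter 2 with at least
          \<open>2 / 3\<close> rounds is enough.\<close>
        have "real (134 * (2 * k)) \<le> real n" using n by (simp add: C1_def)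
        then have "134 * (2 * k) \<le> n" by (simp only: of_nat_le_iff)
        then obtain G where G: "kecss_input i w k n G" "hop_diameter G = 2"
          "real (2::nat) \<le> 3 * real (rounds \<gamma> k \<alpha> A G)"
          using rounds_ge_diameter[OF alg assms(1-3) k, of 2 n] by auto
        have "1 * real k \<le> (2 * C1) * real k" by (intro mult_right_mono) (auto simp: C1_def)
        then have "real k \<le> real n" using n by linarith
        then have nk: "1 \<le> real n / real k" using k by simp
        have "real n / real k < C1 * (C1 * log 2 (real n) + 1)"
          using False k by (simp add: C1_def field_simps)
        also have "\<dots> \<le> K * log 2 (real n)"
          using lg by (simp add: K_def C1_def algebra_simps)
        finally have "real n / real k \<le> K * log 2 (real n)" by simp
        moreover have "sqrt (real n / real k) \<le> real n / real k"
          using nk by (intro real_le_lsqrt self_le_power) auto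
        ultimately have "sqrt (real n / real k) \<le> K * log 2 (real n)" by linarith
        then have "sqrt (real n / real k) / log 2 (real n) \<le> K"
          using lg by (simp add: divide_le_eq)
        then have "c * lower_bound k n 2 \<le> c * (2 + K)"
          using c by (intro mult_left_mono) (auto simp: lower_bound_def)
        also have "\<dots> \<le> 1 / (3 * (2 + K)) * (2 + K)"
          using c by (intro mult_right_mono) (auto simp: K_def C1_def)
        also have "\<dots> \<le> 2 / 3" by (simp add: K_def C1_def)
        finally have "c * lower_bound k n 2 \<le> real (rounds \<gamma> k \<alpha> A G)" using G(3) by simp
        then show ?thesis using G lg by (intro exI[of _ G]) (simp add: C1_def)
      qed
    qed
  qed
  show ?thesis
    using main c(1) by (intro exI[of _ c] conjI exI[of _ "2 * C1"]) (auto simp: C1_def)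
qed

end
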